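(* Let $P$ be a Markov transition kernel on a general state space $(\mathsf{X},\mathcal{B}(\mathsf{X}))$. Assume that the associated Markov chain $X=\{X_n:n=0,1,2,\ldots\}$ is $\pi$-irreducible and positive Harris recurrent, where $\pi$ is the invariant probability measure. Assume that there exist $C\in\mathcal{B}(\mathsf{X})$ with $\pi(C)>0$, $\varepsilon>0$ and a probability measure $\nu$ on $\mathcal{B}(\mathsf{X})$ with $$P(x,A)\ge\varepsilon\,\nu(A)\qquad\text{for all }x\in C,\ A\in\mathcal{B}(\mathsf{X}),$$ and that, with the same set $C$, for some measurable $V:\mathsf{X}\to[1,\infty)$, some $0<\lambda<1$ and some $b<\infty$, $$PV(x):=\int_{\mathsf{X}}V(y)\,P(x,dy)\le\lambda V(x)+b\,I_C(x)\qquad\text{for all }x\in\mathsf{X}.$$ Put $A=\sup_{x\in C}PV(x)$ and $J=(A-\varepsilon)/\lambda$. Let $\beta^*=\lambda^{-1}$ if $J<1$, and $$\beta^*=\exp\left\{\frac{\log\lambda\,\log(1-\varepsilon)}{\log J-\log(1-\varepsilon)}\right\}\quad\text{if }J\ge1.$$ For $\beta\in(1,\beta^* )$ let $\phi(\beta)=\log\beta/\log\lambda^{-1}$ and $$g(\beta,\varepsilon,J)=\beta\,[\nu(V)]^{\phi(\beta)}\left[\frac{1-\beta(1-\varepsilon)}{1-(1-\varepsilon)\left(\frac{J}{1-\varepsilon}\right)^{\phi(\beta)}}\right],\qquad \nu(V)=\int_{\mathsf{X}}V\,d\nu .$$ Fix $\gamma>0$ and $\beta\in(1,\beta^* )$,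 and let $M$ be any positive integer larger than $$\log\left[\frac{2\,g(\beta,\varepsilon,J)}{\gamma(\beta-1)}\right]\Big/\log\beta .$$ Let $X'=\{(X_n,\delta_n)\}$ be the split chain, $\alpha=C\times\{1\}$, $\tau_\alpha=\min\{n\ge1:(X_n,\delta_n)\in\alpha\}$, and let $\Pr_\alpha$ denote probability conditional on $(X_0,\delta_0)\in\alpha$. For $t\in\{1,\ldots,M\}$ define $$\tilde p_t=\frac{\Pr_\alpha(\tau_\alpha\ge t)}{\sum_{s=1}^{M}\Pr_\alpha(\tau_\alpha\ge s)},\qquad Q_t(\cdot)=\Pr_\alpha(X_t\in\cdot\mid\tau_\alpha\ge t),$$ and let $\tilde\pi(\cdot)=\sum_{t=1}^{M}Q_t(\cdot)\,\tilde p_t$. Then $$\|\pi(\cdot)-\tilde\pi(\cdot)\|\le\gamma,$$ where $\|\cdot\|$ denotes total variation distance.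
   Context: Total variation distance between probability measures $\mu_1,\mu_2$ on $\mathcal{B}(\mathsf{X})$: $\|\mu_1-\mu_2\|=\sup_{B\in\mathcal{B}(\mathsf{X})}|\mu_1(B)-\mu_2(B)|$. $I_C$ is the indicator function of $C$. Split chain. Given the minorization condition $P(x,\cdot)\ge\varepsilon\nu(\cdot)$ for $x\in C$, define for $x\in C$ the residual measure $R(x,\cdot)=(1-\varepsilon)^{-1}\big(P(x,\cdot)-\varepsilon\nu(\cdot)\big)$ (with $R(x,\cdot):=0$ if $\varepsilon=1$), so that $P(x,\cdot)=\varepsilon\nu(\cdot)+(1-\varepsilon)R(x,\cdot)$ on $C$. The split chain $X'=\{(X_n,\delta_n):n=0,1,\ldots\}$ is the Markov chain on $\mathsf{X}\times\{0,1\}$ with transition kernel $P'$ given, for $B\in\mathcal{B}(\mathsf{X})$ and $\delta\in\{0,1\}$, by $$P'[(x,0),B\times\{\delta\}]=\begin{cases}[\varepsilon\delta+(1-\varepsilon)(1-\delta)]\,P(x,B),& x\notin C,\\ [\varepsilon\delta+(1-\varepsilon)(1-\delta)]\,R(x,B),& x\in C,\end{cases}$$ $$P'[(x,1),B\times\{\delta\}]=\begin{cases}[\varepsilon\delta+(1-\varepsilon)(1-\delta)]\,P(x,B),& x\notin C,\\ [\varepsilon\delta+(1-\varepsilon)(1-\delta)]\,\nu(B),& x\in C.\end{cases}$$ (When $\varepsilon=1$, states $(x,0)$ are never entered.) Since the transition law out of any point of $\alpha=C\times\{1\}$ is the same (it is $X_1\sim\nu$ with, independently, $\delta_1\sim\mathrm{Bernoulli}(\varepsilon)$),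 conditioning on $(X_0,\delta_0)\in\alpha$ is unambiguous and amounts to starting with $X_1\sim\nu$. Conventions. If $\Pr_\alpha(\tau_\alpha\ge t)=0$, then $\tilde p_t=0$ and the term $Q_t(\cdot)\tilde p_t$ is interpreted as $0$. If $A=\infty$, then $\beta^*$ is read as $1$ and there is no admissible $\beta$. If $\varepsilon=1$ (and $A<\infty$), the formulas are read as their limits as $\varepsilon\uparrow1$: $\beta^*=\lambda^{-1}$ and $g=\beta[\nu(V)]^{\phi(\beta)}$. *)

theory Defs
  imports "HOL-Probability.Probability"
begin

section \<open>Markov chains on a general state space\<close>

text \<open>
  A transition kernel on a measurable space \<open>S\<close> is an element \<open>K\<close> of
  \<open>S \<rightarrow>\<^sub>M prob_algebra S\<close>. The chain with kernel \<open>K\<close> is described through its defining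
  property: for every event \<open>D\<close> of the history up to time \<open>n\<close>, the probability that \<open>D\<close> occurs
  and \<open>X (Suc n) \<in> B\<close> is the integral over \<open>D\<close> of \<open>K (X n) B\<close>.
  The initial law is that of \<open>X 0\<close> and is left open. The definition only looks at \<open>K\<close> along
  the trajectory, so it also makes sense if \<open>K x\<close> is not a probability measure at states
  that are never entered.
\<close>

definition markov_chain ::
  "'w measure \<Rightarrow> 'a measure \<Rightarrow> ('a \<Rightarrow> 'a measure) \<Rightarrow> (nat \<Rightarrow> 'w \<Rightarrow> 'a) \<Rightarrow> bool" where
  "markov_chain \<Omega> S K X \<longleftrightarrow>
     prob_space \<Omega> \<and> (\<forall>n. X n \<in> \<Omega> \<rightarrow>\<^sub>M S) \<and>
     (\<forall>n. \<forall>D \<in> sets (PiM {..n} (\<lambda>_. S)). \<forall>B \<in> sets S.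
        emeasure \<Omega> {\<omega> \<in> space \<Omega>. (\<lambda>i\<in>{..n}. X i \<omega>) \<in> D \<and> X (Suc n) \<omega> \<in> B} =
        (\<integral>\<^sup>+ \<omega> \<in> {\<omega> \<in> space \<Omega>. (\<lambda>i\<in>{..n}. X i \<omega>) \<in> D}. emeasure (K (X n \<omega>)) B \<partial>\<Omega>))"

primrec kernel_power :: "'a measure \<Rightarrow> ('a \<Rightarrow> 'a measure) \<Rightarrow> nat \<Rightarrow> 'a \<Rightarrow> 'a measure" where
  "kernel_power S K 0 x = return S x"
| "kernel_power S K (Suc n) x = K x \<bind> kernel_power S K n"

definition irreducible_kernel :: "'a measure \<Rightarrow> ('a \<Rightarrow> 'a measure) \<Rightarrow> 'a measure \<Rightarrow> bool" where
  "irreducible_kernel S K \<psi> \<longleftrightarrow>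
     (\<forall>x \<in> space S. \<forall>B \<in> sets S. 0 < emeasure \<psi> B \<longrightarrow>
        (\<exists>n\<ge>1. 0 < emeasure (kernel_power S K n x) B))"

definition invariant_prob :: "'a measure \<Rightarrow> ('a \<Rightarrow> 'a measure) \<Rightarrow> 'a measure \<Rightarrow> bool" where
  "invariant_prob S K \<pi> \<longleftrightarrow> \<pi> \<in> space (prob_algebra S) \<and> \<pi> \<bind> K = \<pi>"

text \<open>
  Positive Harris recurrence with invariant probability \<open>\<pi>\<close>: the chain is \<open>\<pi>\<close>-irreducible,
  and from every starting point it visits every set of positive \<open>\<pi>\<close>-measure infinitely often
  with probability one. (An invariant \<open>\<pi>\<close> for which the kernel is \<open>\<pi>\<close>-irreducible is a maximal
  irreducibility measure, so these are the right sets to test.) The measure \<open>L\<close> below is the law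
  of the chain started at \<open>x\<close> on the sequence space, with the coordinates as the process; it
  exists (\<open>markov_chain_exists\<close> below) and is uniquely determined by \<open>K\<close> and \<open>x\<close>.
\<close>

definition path_law ::
  "'a measure \<Rightarrow> ('a \<Rightarrow> 'a measure) \<Rightarrow> 'a measure \<Rightarrow> (nat \<Rightarrow> 'a) measure \<Rightarrow> bool" where
  "path_law S K \<mu> L \<longleftrightarrow>
     sets L = sets (PiM UNIV (\<lambda>_. S)) \<and> markov_chain L S K (\<lambda>n \<omega>. \<omega> n) \<and>
     distr L S (\<lambda>\<omega>. \<omega> 0) = \<mu>"

definition positive_Harris_recurrent ::
  "'a measure \<Rightarrow> ('a \<Rightarrow> 'a measure) \<Rightarrow> 'a measure \<Rightarrow> bool" where
  "positive_Harris_recurrent S K \<pi> \<longleftrightarrow>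
     invariant_prob S K \<pi> \<and> irreducible_kernel S K \<pi> \<and>
     (\<forall>x \<in> space S. \<forall>B \<in> sets S. 0 < emeasure \<pi> B \<longrightarrow>
        (\<forall>L. path_law S K (return S x) L \<longrightarrow> (AE \<omega> in L. \<exists>\<^sub>\<infinity>n. \<omega> n \<in> B)))"

lemma markov_chain_exists:
  assumes K [measurable]: "K \<in> S \<rightarrow>\<^sub>M prob_algebra S"
    and \<mu>: "\<mu> \<in> space (prob_algebra S)"
  shows "\<exists>L. path_law S K \<mu> L"
proof -
  define T where "T = (\<lambda>n (\<omega>::nat \<Rightarrow> 'a). if n = 0 then \<mu> else K (\<omega> (n - 1)))"
  have Ks: "K \<in> S \<rightarrow>\<^sub>M subprob_algebra S"
    by (rule measurable_prob_algebraD[OF K])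
  have Kp: "prob_space (K x)" "sets (K x) = sets S" if "x \<in> space S" for x
    using measurable_space[OF K that] by (auto simp: space_prob_algebra)
  have \<mu>p: "prob_space \<mu>" "sets \<mu> = sets S"
    using \<mu> by (auto simp: space_prob_algebra)
  have T1: "T i \<in> PiM {0..<i} (\<lambda>_. S) \<rightarrow>\<^sub>M subprob_algebra S" for i
  proof (cases "i = 0")
    case True
    then show ?thesis
      using \<mu>p by (auto simp: T_def space_subprob_algebra prob_space_imp_subprob_space)
  next
    case False
    then have "(\<lambda>\<omega>. K (\<omega> (i - 1))) \<in> PiM {0..<i} (\<lambda>_. S) \<rightarrow>\<^sub>M subprob_algebra S"
      by (intro measurable_compose[where g=K, OF _ Ks] measurable_component_singleton) auto
    then show ?thesis using False by (simp add: T_def)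
  qed
  have T2: "prob_space (T i \<omega>)" if "\<omega> \<in> space (PiM {0..<i} (\<lambda>_. S))" for i \<omega>
    using that Kp \<mu>p by (cases "i = 0") (auto simp: T_def space_PiM PiE_iff)
  interpret IT: Ionescu_Tulcea T "\<lambda>_. S"
    by (rule Ionescu_Tulcea.intro) (fact T1, fact T2)
  define L where "L = IT.PF.lim"
  define Z where "Z n = IT.C 0 n (\<lambda>_. undefined)" for n
  have ZS: "Z (Suc n) = Z n \<bind> IT.eP n" for n
    by (simp add: Z_def)
  have u: "(\<lambda>_. undefined) \<in> space (PiM {0..<0::nat} (\<lambda>_. S))"
    by (simp add: space_PiM)
  have sZ: "sets (Z n) = sets (PiM {0..<n} (\<lambda>_. S))" "space (Z n) = space (PiM {0..<n} (\<lambda>_. S))" for n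
    unfolding Z_def using IT.sets_C[OF u, of n] IT.space_C[OF u, of n] by simp_all
  have sL: "sets L = sets (PiM UNIV (\<lambda>_. S))"
    by (simp add: L_def)
  have spL: "space L = space (PiM UNIV (\<lambda>_. S))"
    by (rule sets_eq_imp_space_eq[OF sL])
  have co [measurable]: "(\<lambda>\<omega>. \<omega> n) \<in> L \<rightarrow>\<^sub>M S" for n
    unfolding measurable_cong_sets[OF sL refl] by (rule measurable_component_singleton) simp
  have re: "(\<lambda>\<omega>. restrict \<omega> J) \<in> L \<rightarrow>\<^sub>M PiM J (\<lambda>_. S)" for J
    unfolding measurable_cong_sets[OF sL refl] by (rule measurable_restrict_subset) simp
  have LZ: "distr L (PiM {0..<n} (\<lambda>_. S)) (\<lambda>\<omega>. restrict \<omega> {0..<n}) = Z n" for n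
  proof (rule measure_eqI)
    fix A assume "A \<in> sets (distr L (PiM {0..<n} (\<lambda>_. S)) (\<lambda>\<omega>. restrict \<omega> {0..<n}))"
    then have A: "A \<in> sets (PiM {0..<n} (\<lambda>_. S))" by simp
    have "distr L (PiM {0..<n} (\<lambda>_. S)) (\<lambda>\<omega>. restrict \<omega> {0..<n}) = IT.CI {0..<n}"
      unfolding L_def by (rule IT.distr_lim) simp
    then show "emeasure (distr L (PiM {0..<n} (\<lambda>_. S)) (\<lambda>\<omega>. restrict \<omega> {0..<n})) A = emeasure (Z n) A"
      using IT.emeasure_CI[of "{0..<n}" n A] A sets.sets_into_space[OF A]
      by (simp add: Z_def prod_emb_id space_PiM)
  qed (simp add: sZ)
  have pZ: "prob_space (Z n)" for n
    unfolding Z_def using u by (rule IT.prob_space_C)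
  have pL: "prob_space L"
    using prob_space_distrD[OF re] pZ unfolding LZ[symmetric] by blast
  have mc: "emeasure L {\<omega> \<in> space L. (\<lambda>i\<in>{..n}. \<omega> i) \<in> D \<and> \<omega> (Suc n) \<in> B} =
      (\<integral>\<^sup>+ \<omega> \<in> {\<omega> \<in> space L. (\<lambda>i\<in>{..n}. \<omega> i) \<in> D}. emeasure (K (\<omega> n)) B \<partial>L)"
    if D0: "D \<in> sets (PiM {..n} (\<lambda>_. S))" and B [measurable]: "B \<in> sets S" for n D B
  proof -
    have n: "{..n} = {0..<Suc n}" by auto
    have D [measurable]: "D \<in> sets (PiM {0..<Suc n} (\<lambda>_. S))" using D0 by (simp add: n)
    define E where "E = {\<omega> \<in> space (PiM {0..<Suc (Suc n)} (\<lambda>_. S)).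
        restrict \<omega> {0..<Suc n} \<in> D \<and> \<omega> (Suc n) \<in> B}"
    have [measurable]: "(\<lambda>\<omega>. restrict \<omega> {0..<Suc n}) \<in>
        PiM {0..<Suc (Suc n)} (\<lambda>_. S) \<rightarrow>\<^sub>M PiM {0..<Suc n} (\<lambda>_. S)"
      by (rule measurable_restrict_subset) auto
    have [measurable]: "(\<lambda>\<omega>. \<omega> (Suc n)) \<in> PiM {0..<Suc (Suc n)} (\<lambda>_. S) \<rightarrow>\<^sub>M S"
      by (rule measurable_component_singleton) simp
    have [measurable]: "(\<lambda>\<omega>. \<omega> n) \<in> PiM {0..<Suc n} (\<lambda>_. S) \<rightarrow>\<^sub>M S"
      by (rule measurable_component_singleton) simp
    have E [measurable]: "E \<in> sets (PiM {0..<Suc (Suc n)} (\<lambda>_. S))"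
      unfolding E_def by measurable
    have "emeasure L {\<omega> \<in> space L. (\<lambda>i\<in>{..n}. \<omega> i) \<in> D \<and> \<omega> (Suc n) \<in> B} =
        emeasure (Z (Suc (Suc n))) E"
    proof -
      have "{\<omega> \<in> space L. (\<lambda>i\<in>{..n}. \<omega> i) \<in> D \<and> \<omega> (Suc n) \<in> B} =
          (\<lambda>\<omega>. restrict \<omega> {0..<Suc (Suc n)}) -` E \<inter> space L"
        using measurable_space[OF re, of _ "{0..<Suc (Suc n)}"]
        by (auto simp: E_def n restrict_restrict Int_absorb1 simp del: restrict_apply)
           (auto simp: Int_absorb1)
      then show ?thesis
        unfolding LZ[symmetric] using emeasure_distr[OF re E] by simp
    qed
    also have "\<dots> = (\<integral>\<^sup>+ \<omega>. emeasure (IT.eP (Suc n) \<omega>) E \<partial>Z (Suc n))"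
      unfolding ZS[of "Suc n"]
    proof (rule emeasure_bind)
      show "space (Z (Suc n)) \<noteq> {}" by (rule prob_space.not_empty[OF pZ])
      show "IT.eP (Suc n) \<in> Z (Suc n) \<rightarrow>\<^sub>M subprob_algebra (PiM {0..<Suc (Suc n)} (\<lambda>_. S))"
        unfolding measurable_cong_sets[OF sZ(1) refl] by (rule IT.measurable_eP)
    qed (rule E)
    also have "\<dots> = (\<integral>\<^sup>+ \<omega>. indicator D \<omega> * emeasure (K (\<omega> n)) B \<partial>Z (Suc n))"
    proof (rule nn_integral_cong)
      fix \<omega> assume "\<omega> \<in> space (Z (Suc n))"
      then have w: "\<omega> \<in> space (PiM {0..<Suc n} (\<lambda>_. S))" by (simp add: sZ)
      then have wn: "\<omega> n \<in> space S" by (auto simp: space_PiM PiE_iff)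
      have r: "restrict (fun_upd \<omega> (Suc n) y) {0..<Suc n} = \<omega>" for y
        using w by (auto simp: space_PiM PiE_iff extensional_def restrict_def fun_eq_iff)
      have m: "fun_upd \<omega> (Suc n) y \<in> space (PiM {0..<Suc (Suc n)} (\<lambda>_. S)) \<longleftrightarrow> y \<in> space S" for y
        using w by (auto simp: space_PiM PiE_iff extensional_def)
      have "emeasure (IT.eP (Suc n) \<omega>) E = emeasure (K (\<omega> n)) ((\<lambda>y. fun_upd \<omega> (Suc n) y) -` E \<inter> space S)"
        using IT.emeasure_eP[OF w E] by (simp add: T_def)
      also have "(\<lambda>y. fun_upd \<omega> (Suc n) y) -` E \<inter> space S = (if \<omega> \<in> D then B else {})"
        using sets.sets_into_space[OF B] by (auto simp: E_def r m)
      finally show "emeasure (IT.eP (Suc n) \<omega>) E = indicator D \<omega> * emeasure (K (\<omega> n)) B"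
        by (simp split: split_indicator)
    qed
    also have "\<dots> = (\<integral>\<^sup>+ \<omega>. indicator D (restrict \<omega> {0..<Suc n}) *
        emeasure (K (restrict \<omega> {0..<Suc n} n)) B \<partial>L)"
      unfolding LZ[symmetric]
      by (rule nn_integral_distr[OF re])
         (measurable, rule measurable_compose[where g=K, OF _ Ks], measurable)
    also have "\<dots> = (\<integral>\<^sup>+ \<omega> \<in> {\<omega> \<in> space L. (\<lambda>i\<in>{..n}. \<omega> i) \<in> D}. emeasure (K (\<omega> n)) B \<partial>L)"
      by (rule nn_integral_cong) (auto simp: n split: split_indicator)
    finally show ?thesis .
  qed
  have "distr L S (\<lambda>\<omega>. \<omega> 0) = \<mu>"
  proof (rule measure_eqI)
    fix B assume "B \<in> sets (distr L S (\<lambda>\<omega>. \<omega> 0))"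
    then have B [measurable]: "B \<in> sets S" by simp
    define E where "E = {\<omega> \<in> space (PiM {0..<Suc 0} (\<lambda>_. S)). \<omega> 0 \<in> B}"
    have [measurable]: "(\<lambda>\<omega>. \<omega> 0) \<in> PiM {0..<Suc 0} (\<lambda>_. S) \<rightarrow>\<^sub>M S"
      by (rule measurable_component_singleton) simp
    have E: "E \<in> sets (PiM {0..<Suc 0} (\<lambda>_. S))" unfolding E_def by measurable
    have "emeasure (distr L S (\<lambda>\<omega>. \<omega> 0)) B = emeasure L ((\<lambda>\<omega>. restrict \<omega> {0..<Suc 0}) -` E \<inter> space L)"
      using measurable_space[OF re, of _ "{0..<Suc 0}"]
      by (subst emeasure_distr) (auto simp: E_def intro!: arg_cong[where f="emeasure L"])
    also have "\<dots> = emeasure (Z (Suc 0)) E"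
      unfolding LZ[symmetric] using emeasure_distr[OF re E] by simp
    also have "\<dots> = (\<integral>\<^sup>+ \<omega>. emeasure (IT.eP 0 \<omega>) E \<partial>return (PiM {0..<0} (\<lambda>_. S)) (\<lambda>_. undefined))"
      unfolding Z_def IT.C.simps add_0
      by (rule emeasure_bind[where N="PiM {0..<Suc 0} (\<lambda>_. S)"])
         (use u IT.measurable_eP[of 0] E in auto)
    also have "\<dots> = emeasure (IT.eP 0 (\<lambda>_. undefined)) E"
      by (rule nn_integral_return[OF u])
         (use measurable_compose[OF IT.measurable_eP measurable_emeasure_subprob_algebra[OF E]] in simp)
    also have "\<dots> = emeasure \<mu> ((\<lambda>y. fun_upd (\<lambda>_. undefined) 0 y) -` E \<inter> space S)"
      using IT.emeasure_eP[OF u E] by (simp add: T_def)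
    also have "(\<lambda>y. fun_upd (\<lambda>_. undefined) 0 y) -` E \<inter> space S = B"
      using sets.sets_into_space[OF B] by (auto simp: E_def space_PiM PiE_iff extensional_def)
    finally show "emeasure (distr L S (\<lambda>\<omega>. \<omega> 0)) B = emeasure \<mu> B" .
  qed (simp add: \<mu>p)
  then show ?thesis
    unfolding path_law_def markov_chain_def using sL pL co mc by blast
qed

section \<open>The split chain\<close>

text \<open>
  The second coordinate of the split chain is a \<open>bool\<close>, with \<open>True\<close> for \<open>1\<close>. The residual
  measure is an genuine measure as soon as the minorization condition holds at \<open>x\<close>
  (\<open>emeasure_residual\<close>).
\<close>

definition residual :: "('a \<Rightarrow> 'a measure) \<Rightarrow> real \<Rightarrow> 'a measure \<Rightarrow> 'a \<Rightarrow> 'a measure" where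
  "residual P \<epsilon> \<nu> x =
     (if \<epsilon> = 1 then null_measure \<nu>
      else scale_measure (ennreal (inverse (1 - \<epsilon>))) (diff_measure (P x) (scale_measure (ennreal \<epsilon>) \<nu>)))"

lemma emeasure_residual:
  assumes P: "prob_space (P x)" "sets (P x) = sets \<nu>" and \<nu>: "prob_space \<nu>"
    and \<epsilon>: "0 < \<epsilon>" "\<epsilon> \<noteq> 1"
    and minor: "\<And>B. B \<in> sets \<nu> \<Longrightarrow> \<epsilon> * measure \<nu> B \<le> measure (P x) B"
    and B: "B \<in> sets \<nu>"
  shows "emeasure (residual P \<epsilon> \<nu> x) B =
    ennreal (inverse (1 - \<epsilon>) * (measure (P x) B - \<epsilon> * measure \<nu> B))"
proof -
  interpret P: prob_space "P x" by fact
  interpret \<nu>: prob_space \<nu> by fact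
  have "\<epsilon> \<le> 1"
    using minor[of "space \<nu>"] P.prob_space \<nu>.prob_space sets_eq_imp_space_eq[OF P(2)] by simp
  have le: "emeasure (scale_measure (ennreal \<epsilon>) \<nu>) A \<le> emeasure (P x) A" if "A \<in> sets \<nu>" for A
    using minor[OF that] \<epsilon>
    by (simp add: P.emeasure_eq_measure \<nu>.emeasure_eq_measure ennreal_mult'[symmetric])
  have "finite_measure (scale_measure (ennreal \<epsilon>) \<nu>)"
    by (intro finite_measureI) (simp add: \<nu>.emeasure_eq_measure ennreal_mult'[symmetric] ennreal_mult_eq_top_iff)
  then have "emeasure (diff_measure (P x) (scale_measure (ennreal \<epsilon>) \<nu>)) B =
      emeasure (P x) B - emeasure (scale_measure (ennreal \<epsilon>) \<nu>) B"
    using P B le by (intro emeasure_diff_measure P.finite_measure_axioms) auto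
  also have "\<dots> = ennreal (measure (P x) B - \<epsilon> * measure \<nu> B)"
    using \<epsilon> by (simp add: P.emeasure_eq_measure \<nu>.emeasure_eq_measure ennreal_mult'[symmetric] ennreal_minus)
  finally show ?thesis
    using \<epsilon> \<open>\<epsilon> \<le> 1\<close> by (simp add: residual_def ennreal_mult'[symmetric])
qed

definition split_space :: "'a measure \<Rightarrow> ('a \<times> bool) measure" where
  "split_space S = S \<Otimes>\<^sub>M count_space UNIV"

definition split_kernel ::
  "('a \<Rightarrow> 'a measure) \<Rightarrow> 'a set \<Rightarrow> real \<Rightarrow> 'a measure \<Rightarrow> 'a \<times> bool \<Rightarrow> ('a \<times> bool) measure" where
  "split_kernel P C \<epsilon> \<nu> = (\<lambda>(x, d).
     (if x \<notin> C then P x else if d then \<nu> else residual P \<epsilon> \<nu> x) \<Otimes>\<^sub>M measure_pmf (bernoulli_pmf \<epsilon>))"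

lemma emeasure_split_kernel:
  assumes "sets (P x) = sets S" "sets \<nu> = sets S" "B \<in> sets S" "0 \<le> \<epsilon>" "\<epsilon> \<le> 1"
  shows "emeasure (split_kernel P C \<epsilon> \<nu> (x, d)) (B \<times> {d'}) =
    ennreal (\<epsilon> * of_bool d' + (1 - \<epsilon>) * (1 - of_bool d')) *
    (if x \<notin> C then emeasure (P x) B else if d then emeasure \<nu> B else emeasure (residual P \<epsilon> \<nu> x) B)"
proof -
  have "sets (residual P \<epsilon> \<nu> x) = sets S"
    using assms by (simp add: residual_def)
  moreover have "emeasure (measure_pmf (bernoulli_pmf \<epsilon>)) {d'} =
      ennreal (\<epsilon> * of_bool d' + (1 - \<epsilon>) * (1 - of_bool d'))"
    using assms by (cases d') (simp_all add: emeasure_pmf_single)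
  ultimately show ?thesis
    using assms
    by (simp add: split_kernel_def mult.commute
        sigma_finite_measure.emeasure_pair_measure_Times[OF measure_pmf.sigma_finite_measure_axioms])
qed

definition atom :: "'a set \<Rightarrow> ('a \<times> bool) set" where
  "atom C = C \<times> {True}"

section \<open>The truncated mixture\<close>

text \<open>The infimum is \<open>\<infinity>\<close> if \<open>A\<close> is not visited at a time \<open>n \<ge> 1\<close>.\<close>

definition return_time :: "(nat \<Rightarrow> 'w \<Rightarrow> 'b) \<Rightarrow> 'b set \<Rightarrow> 'w \<Rightarrow> enat" where
  "return_time Y A \<omega> = (INF n \<in> {n. 1 \<le> n \<and> Y n \<omega> \<in> A}. enat n)"

text \<open>
  \<^const>\<open>uniform_measure\<close> \<open>\<Omega> E\<close> is the conditional probability measure given the event \<open>E\<close>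
  (and the null measure if \<open>E\<close> has probability zero).
\<close>

definition start_in :: "'w measure \<Rightarrow> (nat \<Rightarrow> 'w \<Rightarrow> 'b) \<Rightarrow> 'b set \<Rightarrow> 'w measure" where
  "start_in \<Omega> Y A = uniform_measure \<Omega> {\<omega> \<in> space \<Omega>. Y 0 \<omega> \<in> A}"

definition no_return_before :: "'w measure \<Rightarrow> (nat \<Rightarrow> 'w \<Rightarrow> 'b) \<Rightarrow> 'b set \<Rightarrow> nat \<Rightarrow> 'w set" where
  "no_return_before \<Omega> Y A t = {\<omega> \<in> space \<Omega>. enat t \<le> return_time Y A \<omega>}"

definition p_tilde :: "'w measure \<Rightarrow> (nat \<Rightarrow> 'w \<Rightarrow> 'b) \<Rightarrow> 'b set \<Rightarrow> nat \<Rightarrow> nat \<Rightarrow> real" where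
  "p_tilde \<Omega> Y A M t =
     measure (start_in \<Omega> Y A) (no_return_before \<Omega> Y A t) /
     (\<Sum>s = 1..M. measure (start_in \<Omega> Y A) (no_return_before \<Omega> Y A s))"

definition Q_law ::
  "'a measure \<Rightarrow> 'w measure \<Rightarrow> (nat \<Rightarrow> 'w \<Rightarrow> 'a \<times> bool) \<Rightarrow> ('a \<times> bool) set \<Rightarrow> nat \<Rightarrow> 'a measure" where
  "Q_law S \<Omega> Y A t =
     distr (uniform_measure (start_in \<Omega> Y A) (no_return_before \<Omega> Y A t)) S (\<lambda>\<omega>. fst (Y t \<omega>))"

definition pi_tilde ::
  "'a measure \<Rightarrow> 'w measure \<Rightarrow> (nat \<Rightarrow> 'w \<Rightarrow> 'a \<times> bool) \<Rightarrow> ('a \<times> bool) set \<Rightarrow> nat \<Rightarrow> 'a measure" where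
  "pi_tilde S \<Omega> Y A M =
     measure_of (space S) (sets S)
       (\<lambda>B. \<Sum>t = 1..M. emeasure (Q_law S \<Omega> Y A t) B * ennreal (p_tilde \<Omega> Y A M t))"

lemma sets_pi_tilde [simp]: "sets (pi_tilde S \<Omega> Y A M) = sets S"
  by (simp add: pi_tilde_def)

lemma emeasure_pi_tilde:
  assumes "B \<in> sets S"
  shows "emeasure (pi_tilde S \<Omega> Y A M) B =
    (\<Sum>t = 1..M. emeasure (Q_law S \<Omega> Y A t) B * ennreal (p_tilde \<Omega> Y A M t))"
  unfolding pi_tilde_def
proof (rule emeasure_measure_of_sigma)
  let ?m = "\<lambda>B. \<Sum>t = 1..M. emeasure (Q_law S \<Omega> Y A t) B * ennreal (p_tilde \<Omega> Y A M t)"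
  show "sigma_algebra (space S) (sets S)" ..
  show "positive (sets S) ?m"
    by (simp add: positive_def)
  show "countably_additive (sets S) ?m"
  proof (rule countably_additiveI)
    fix F :: "nat \<Rightarrow> 'a set"
    assume F: "range F \<subseteq> sets S" "disjoint_family F"
    have "(\<Sum>i. ?m (F i)) =
        (\<Sum>t = 1..M. \<Sum>i. emeasure (Q_law S \<Omega> Y A t) (F i) * ennreal (p_tilde \<Omega> Y A M t))"
      by (rule suminf_sum) simp
    also have "\<dots> = ?m (\<Union>i. F i)"
      using F by (simp add: suminf_emeasure Q_law_def)
    finally show "(\<Sum>i. ?m (F i)) = ?m (\<Union>i. F i)" .
  qed
qed fact

definition tv_dist :: "'a measure \<Rightarrow> 'a measure \<Rightarrow> real" where
  "tv_dist \<mu>\<^sub>1 \<mu>\<^sub>2 = (SUP B \<in> sets \<mu>\<^sub>1. \<bar>measure \<mu>\<^sub>1 B - measure \<mu>\<^sub>2 B\<bar>)"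

section \<open>The constants of the drift and minorization conditions\<close>

definition kernel_fun :: "('a \<Rightarrow> 'a measure) \<Rightarrow> ('a \<Rightarrow> real) \<Rightarrow> 'a \<Rightarrow> ennreal" where
  "kernel_fun P V x = (\<integral>\<^sup>+ y. ennreal (V y) \<partial>P x)"

definition sup_PV :: "('a \<Rightarrow> 'a measure) \<Rightarrow> ('a \<Rightarrow> real) \<Rightarrow> 'a set \<Rightarrow> ennreal" where
  "sup_PV P V C = (SUP x \<in> C. kernel_fun P V x)"

definition J_const :: "ennreal \<Rightarrow> real \<Rightarrow> real \<Rightarrow> real" where
  "J_const A \<epsilon> lam = (enn2real A - \<epsilon>) / lam"

text \<open>
  In the next two definitions, \<open>\<epsilon> = 1\<close> is split off because \<open>ln 0 = 0\<close> and \<open>x / 0 = 0\<close>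
  in HOL; the values are the limits of the general formulas as \<open>\<epsilon>\<close> increases to \<open>1\<close>.
  If \<open>A = \<infinity>\<close> then \<open>beta_star\<close> is \<open>1\<close>, so that the interval from \<open>1\<close> to \<open>beta_star\<close> is empty
  (and the junk value of \<open>J_const\<close> is irrelevant).
\<close>

definition beta_star :: "ennreal \<Rightarrow> real \<Rightarrow> real \<Rightarrow> real" where
  "beta_star A \<epsilon> lam =
     (if A = \<infinity> then 1
      else if J_const A \<epsilon> lam < 1 \<or> \<epsilon> = 1 then inverse lam
      else exp (ln lam * ln (1 - \<epsilon>) / (ln (J_const A \<epsilon> lam) - ln (1 - \<epsilon>))))"

definition phi :: "real \<Rightarrow> real \<Rightarrow> real" where
  "phi lam \<beta> = ln \<beta> / ln (inverse lam)"

definition g_const :: "real \<Rightarrow> real \<Rightarrow> real \<Rightarrow> real \<Rightarrow> real \<Rightarrow> real" where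
  "g_const lam \<nu>V \<beta> \<epsilon> J =
     (if \<epsilon> = 1 then \<beta> * \<nu>V powr phi lam \<beta>
      else \<beta> * \<nu>V powr phi lam \<beta> *
        ((1 - \<beta> * (1 - \<epsilon>)) / (1 - (1 - \<epsilon>) * (J / (1 - \<epsilon>)) powr phi lam \<beta>)))"

end

theory Submission
  imports Defs
begin

text \<open>
  Let \<open>T = P - \<epsilon> I\<^sub>C \<nu>\<close>. The law of \<open>X\<^sub>t\<close> restricted to \<open>\<tau>\<^sub>\<alpha> \<ge> t\<close> is \<open>\<nu> T\<^sup>t\<^sup>-\<^sup>1\<close>, and iterating
  \<open>\<pi> = \<pi> P = \<pi> T + \<epsilon> \<pi>(C) \<nu>\<close> gives
  \<open>\<pi> = \<pi> T\<^sup>M + \<epsilon> \<pi>(C) (\<nu> + \<nu> T + \<dots> + \<nu> T\<^sup>M\<^sup>-\<^sup>1)\<close>. The truncated mixture is the normalised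
  second summand, so its distance to \<open>\<pi>\<close> is at most the total mass of \<open>\<pi> T\<^sup>M\<close>.

  By Jensen's inequality the function \<open>f = V\<^sup>\<phi>\<close> satisfies \<open>T f \<le> f / \<beta>\<close>; on \<open>C\<close> this is the
  condition \<open>\<beta> < \<beta>\<^sup>*\<close>. Hence that mass is at most \<open>\<pi>(f) / \<beta>\<^sup>M\<close>, while integrating
  \<open>P f \<le> f / \<beta> + \<epsilon> \<nu>(f)\<close> against \<open>\<pi>\<close> gives \<open>\<pi>(f) \<le> \<beta> \<nu>(V)\<^sup>\<phi> / (\<beta> - 1) \<le> g / (\<beta> - 1)\<close>.
\<close>

section \<open>Drift conditions\<close>

text \<open>Jensen's inequality for a concave power, with only upper bounds on mass and mean, so
  that it applies to subprobability measures. Young's inequality gives the tangent bound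
  \<open>f^p * a^(1-p) \<le> p * f + (1-p) * a\<close>; integrate it and cancel
  \<open>a^(1-p)\<close>.\<close>

lemma nn_integral_powr_le:
  fixes f :: "'a \<Rightarrow> real"
  assumes f [measurable]: "f \<in> borel_measurable N"
    and pos: "\<And>x. x \<in> space N \<Longrightarrow> 0 < f x"
    and p: "0 \<le> p" "p \<le> 1" and a: "0 < a" and m: "0 \<le> m"
    and mass: "emeasure N (space N) \<le> ennreal m"
    and mean: "(\<integral>\<^sup>+x. ennreal (f x) \<partial>N) \<le> ennreal (m * a)"
  shows "(\<integral>\<^sup>+x. ennreal (f x powr p) \<partial>N) \<le> ennreal (m * a powr p)"
proof -
  let ?c = "ennreal (a powr (1 - p))"
  have "?c * (\<integral>\<^sup>+x. ennreal (f x powr p) \<partial>N) = (\<integral>\<^sup>+x. ennreal (f x powr p * a powr (1 - p)) \<partial>N)"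
    by (simp add: nn_integral_cmult[symmetric] ennreal_mult'[symmetric] mult.commute)
  also have "\<dots> \<le> (\<integral>\<^sup>+x. ennreal p * ennreal (f x) + ennreal ((1 - p) * a) \<partial>N)"
    using Youngs_inequality_0[of p "1 - p" _ a] pos p a
    by (intro nn_integral_mono)
       (auto simp: ennreal_mult'[symmetric] ennreal_plus[symmetric] less_imp_le simp del: ennreal_plus
         intro!: ennreal_leI)
  also have "\<dots> = ennreal p * (\<integral>\<^sup>+x. ennreal (f x) \<partial>N) + ennreal ((1 - p) * a) * emeasure N (space N)"
    by (simp add: nn_integral_add nn_integral_cmult)
  also have "\<dots> \<le> ennreal p * ennreal (m * a) + ennreal ((1 - p) * a) * ennreal m"
    using mean mass by (intro add_mono mult_left_mono) auto
  also have "\<dots> = ennreal (m * a)"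
  proof -
    have "p * (m * a) + (1 - p) * a * m = m * a"
      by (simp add: algebra_simps)
    then show ?thesis
      using p a m by (simp add: ennreal_mult'[symmetric] ennreal_plus[symmetric] del: ennreal_plus)
  qed
  also have "m * a = a powr (1 - p) * (m * a powr p)"
    using a by (simp add: powr_diff)
  also have "ennreal \<dots> = ?c * ennreal (m * a powr p)"
    by (simp add: ennreal_mult')
  finally show ?thesis
    using a by (subst (asm) ennreal_mult_le_mult_iff) auto
qed

text \<open>Lifts a decomposition of a measure from sets to integrands. The additive form avoids
  subtracting possibly infinite integrals.\<close>

lemma nn_integral_add_measure:
  fixes f :: "'a \<Rightarrow> ennreal"
  assumes s [measurable_cong]: "sets N = sets M" "sets L = sets M"
    and M: "\<And>B. B \<in> sets M \<Longrightarrow> emeasure M B = c * emeasure N B + emeasure L B"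
    and f: "f \<in> borel_measurable M"
  shows "(\<integral>\<^sup>+x. f x \<partial>M) = c * (\<integral>\<^sup>+x. f x \<partial>N) + (\<integral>\<^sup>+x. f x \<partial>L)"
  using f
proof (induction rule: borel_measurable_induct)
  case (cong f g)
  then have "\<And>x. x \<in> space N \<Longrightarrow> f x = g x" "\<And>x. x \<in> space L \<Longrightarrow> f x = g x"
    using s[THEN sets_eq_imp_space_eq] by auto
  with cong show ?case
    by (simp cong: nn_integral_cong)
next
  case (set B)
  then show ?case
    using M s by simp
next
  case (mult u k)
  note mult(2) [measurable]
  show ?case
    using mult by (simp add: nn_integral_cmult distrib_left mult.left_commute)
next
  case (add u v)
  note add(1,4) [measurable]
  show ?case
    using add by (simp add: nn_integral_add distrib_left algebra_simps)
next
  case (seq U)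
  note seq(1) [measurable]
  have inc: "incseq (\<lambda>i. \<integral>\<^sup>+x. U i x \<partial>K)" for K
    using \<open>incseq U\<close> by (auto simp: incseq_def le_fun_def intro!: nn_integral_mono)
  have "(\<integral>\<^sup>+x. (SUP i. U i) x \<partial>K) = (SUP i. \<integral>\<^sup>+x. U i x \<partial>K)"
    if [measurable_cong]: "sets K = sets M" for K
    using \<open>incseq U\<close> by (simp add: image_comp nn_integral_monotone_convergence_SUP)
  from this[of M] this[of N] this[of L] s show ?case
    using seq inc
    by (auto simp: SUP_mult_left_ennreal ennreal_SUP_add[symmetric] incseq_def mult_left_mono)
qed

lemma invariant_prob_nn_integral:
  assumes K: "K \<in> S \<rightarrow>\<^sub>M prob_algebra S" and \<pi>: "invariant_prob S K \<pi>"
    and f: "f \<in> borel_measurable S"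
  shows "(\<integral>\<^sup>+x. f x \<partial>\<pi>) = (\<integral>\<^sup>+x. \<integral>\<^sup>+y. f y \<partial>K x \<partial>\<pi>)"
proof -
  have "sets \<pi> = sets S"
    using \<pi> by (auto simp: invariant_prob_def space_prob_algebra)
  then have "K \<in> \<pi> \<rightarrow>\<^sub>M subprob_algebra S"
    using measurable_prob_algebraD[OF K] by (simp cong: measurable_cong_sets)
  from nn_integral_bind[OF f this] show ?thesis
    using \<pi> by (simp add: invariant_prob_def)
qed

text \<open>
  Integrability of \<open>f\<close> is not known beforehand, so the drift inequality is integrated for the
  truncations of \<open>f\<close> at level \<open>n\<close>.
\<close>

lemma invariant_prob_drift:
  fixes f :: "'a \<Rightarrow> real"
  assumes K [measurable]: "K \<in> S \<rightarrow>\<^sub>M prob_algebra S" and \<pi>: "invariant_prob S K \<pi>"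
    and f [measurable]: "f \<in> borel_measurable S" and f0: "\<And>x. x \<in> space S \<Longrightarrow> 0 \<le> f x"
    and l: "0 \<le> l" "l < 1" and b: "0 \<le> b"
    and drift: "\<And>x. x \<in> space S \<Longrightarrow> (\<integral>\<^sup>+y. ennreal (f y) \<partial>K x) \<le> ennreal (l * f x + b)"
  shows "(\<integral>\<^sup>+x. ennreal (f x) \<partial>\<pi>) \<le> ennreal (b / (1 - l))"
proof -
  have s [measurable_cong]: "sets \<pi> = sets S" and "prob_space \<pi>"
    using \<pi> by (auto simp: invariant_prob_def space_prob_algebra)
  then interpret prob_space \<pi> by simp
  have sp: "space \<pi> = space S"
    using s by (rule sets_eq_imp_space_eq)
  \<comment> \<open>\<open>h n\<close> is chosen so that
    \<open>h n + min (l * f + b) n \<le> b + min f n\<close> pointwise: where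
    \<open>f \<le> n\<close> the left side is at most \<open>f + b\<close>, and elsewhere
    \<open>h n\<close> vanishes and both minima compare with \<open>n\<close>.\<close>
  define h where "h n x = ennreal ((1 - l) * f x) * indicator {x. f x \<le> real n} x" for n x
  have [measurable]: "{x. f x \<le> real n} \<inter> space S \<in> sets S" for n
    by measurable
  have h [measurable]: "h n \<in> borel_measurable S" for n
    unfolding h_def by measurable
  have bound: "(\<integral>\<^sup>+x. h n x \<partial>\<pi>) \<le> ennreal b" for n
  proof -
    let ?F = "\<integral>\<^sup>+x. ennreal (min (f x) n) \<partial>\<pi>"
    let ?G = "\<integral>\<^sup>+x. ennreal (min (l * f x + b) n) \<partial>\<pi>"
    have "?F = (\<integral>\<^sup>+x. \<integral>\<^sup>+y. ennreal (min (f y) n) \<partial>K x \<partial>\<pi>)"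
      by (rule invariant_prob_nn_integral[OF K \<pi>]) measurable
    also have "\<dots> \<le> ?G"
    proof (rule nn_integral_mono)
      fix x assume "x \<in> space \<pi>"
      then have x: "x \<in> space S" by (simp add: sp)
      interpret K: prob_space "K x"
        using measurable_space[OF K x] by (simp add: space_prob_algebra)
      have "(\<integral>\<^sup>+y. ennreal (min (f y) n) \<partial>K x) \<le> (\<integral>\<^sup>+y. ennreal n \<partial>K x)"
        by (intro nn_integral_mono) (auto intro!: ennreal_leI)
      moreover have "(\<integral>\<^sup>+y. ennreal (min (f y) n) \<partial>K x) \<le> (\<integral>\<^sup>+y. ennreal (f y) \<partial>K x)"
        by (intro nn_integral_mono) (auto intro!: ennreal_leI)
      ultimately show "(\<integral>\<^sup>+y. ennreal (min (f y) n) \<partial>K x) \<le> ennreal (min (l * f x + b) n)"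
        using drift[OF x] by (auto simp: K.emeasure_space_1 min_def)
    qed
    finally have "(\<integral>\<^sup>+x. h n x \<partial>\<pi>) + ?F \<le> (\<integral>\<^sup>+x. h n x \<partial>\<pi>) + ?G"
      by (intro add_left_mono)
    also have "\<dots> = (\<integral>\<^sup>+x. h n x + ennreal (min (l * f x + b) n) \<partial>\<pi>)"
      by (rule nn_integral_add[symmetric]) measurable
    also have "\<dots> \<le> (\<integral>\<^sup>+x. ennreal b + ennreal (min (f x) n) \<partial>\<pi>)"
    proof (rule nn_integral_mono)
      fix x assume "x \<in> space \<pi>"
      then have "0 \<le> f x" "0 \<le> l * f x" "l * f x \<le> f x"
        using f0 l by (auto simp: sp mult_left_le_one_le)
      then show "h n x + ennreal (min (l * f x + b) n) \<le> ennreal b + ennreal (min (f x) n)"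
        using b l
        by (auto simp: h_def indicator_def ennreal_plus[symmetric] algebra_simps simp del: ennreal_plus
            intro!: ennreal_leI)
    qed
    also have "\<dots> = ennreal b + ?F"
      by (subst nn_integral_add) (auto simp: emeasure_space_1)
    \<comment> \<open>Invariance has put \<open>?F\<close> on both sides. The truncation makes it
      finite, at most \<open>n\<close>, so it can be cancelled.\<close>
    finally have "?F + (\<integral>\<^sup>+x. h n x \<partial>\<pi>) \<le> ?F + ennreal b"
      by (simp add: add.commute)
    moreover have "?F \<le> (\<integral>\<^sup>+x. ennreal n \<partial>\<pi>)"
      by (intro nn_integral_mono) (auto intro!: ennreal_leI)
    then have "?F < \<infinity>"
      by (auto simp: emeasure_space_1 le_less_trans)
    ultimately show ?thesis
      by (auto simp: ennreal_add_left_cancel_le)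
  qed
  have "ennreal (1 - l) * (\<integral>\<^sup>+x. ennreal (f x) \<partial>\<pi>) = (\<integral>\<^sup>+x. ennreal ((1 - l) * f x) \<partial>\<pi>)"
    using l by (simp add: nn_integral_cmult[symmetric] ennreal_mult'[symmetric])
  \<comment> \<open>Every \<open>f x\<close> lies below some \<open>n\<close>, so the
    \<open>h n\<close> increase to \<open>(1 - l) * f\<close> and the uniform bound passes to the
    limit.\<close>
  also have "\<dots> = (\<integral>\<^sup>+x. (SUP n. h n x) \<partial>\<pi>)"
  proof (rule nn_integral_cong, rule antisym)
    fix x
    obtain n where "f x \<le> real n"
      using real_arch_simple by blast
    then have "ennreal ((1 - l) * f x) = h n x"
      by (simp add: h_def)
    then show "ennreal ((1 - l) * f x) \<le> (SUP n. h n x)"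
      by (auto intro: SUP_upper2)
    show "(SUP n. h n x) \<le> ennreal ((1 - l) * f x)"
      by (auto intro!: SUP_least simp: h_def indicator_def)
  qed
  also have "\<dots> = (SUP n. \<integral>\<^sup>+x. h n x \<partial>\<pi>)"
    by (rule nn_integral_monotone_convergence_SUP)
       (auto simp: incseq_def le_fun_def h_def indicator_def)
  also have "\<dots> \<le> ennreal b"
    using bound by (auto intro: SUP_least)
  also have "b = (1 - l) * (b / (1 - l))"
    using l by simp
  also have "ennreal \<dots> = ennreal (1 - l) * ennreal (b / (1 - l))"
    using l by (intro ennreal_mult) (use b in auto)
  finally show ?thesis
    using l by (subst (asm) ennreal_mult_le_mult_iff) auto
qed

section \<open>The taboo kernel\<close>

locale minorized_kernel =
  fixes S :: "'a measure" and P :: "'a \<Rightarrow> 'a measure" and C :: "'a set"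
    and \<epsilon> :: real and \<nu> :: "'a measure"
  assumes kernel [measurable]: "P \<in> S \<rightarrow>\<^sub>M prob_algebra S"
    and C_sets [measurable]: "C \<in> sets S"
    and eps: "0 < \<epsilon>" "\<epsilon> \<le> 1"
    and nu_prob_algebra: "\<nu> \<in> space (prob_algebra S)"
    and minorization: "\<And>x B. x \<in> C \<Longrightarrow> B \<in> sets S \<Longrightarrow> \<epsilon> * measure \<nu> B \<le> measure (P x) B"
begin

lemma prob_space_P: "prob_space (P x)" and sets_P: "sets (P x) = sets S" if "x \<in> space S"
  using measurable_space[OF kernel that] by (auto simp: space_prob_algebra)

lemma prob_space_nu: "prob_space \<nu>" and sets_nu [measurable_cong]: "sets \<nu> = sets S"
  using nu_prob_algebra by (auto simp: space_prob_algebra)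

lemma space_nu: "space \<nu> = space S"
  using sets_nu by (rule sets_eq_imp_space_eq)

lemma space_S: "space S \<noteq> {}"
  using prob_space.not_empty[OF prob_space_nu] by (simp add: space_nu)

text \<open>
  This is \<open>T = P - \<epsilon> I\<^sub>C \<nu>\<close> (\<open>emeasure_P_eq_taboo\<close>). The form with the residual measure makes
  it a kernel of measures, and it also covers \<open>\<epsilon> = 1\<close>, where \<open>T x\<close> is null on \<open>C\<close>.
\<close>

definition taboo :: "'a \<Rightarrow> 'a measure" where
  "taboo x = (if x \<in> C then scale_measure (ennreal (1 - \<epsilon>)) (residual P \<epsilon> \<nu> x) else P x)"

lemma sets_taboo: "x \<in> space S \<Longrightarrow> sets (taboo x) = sets S"
  using sets_P sets_nu by (auto simp: taboo_def residual_def)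

lemma emeasure_P_eq_taboo:
  assumes x: "x \<in> space S" and B: "B \<in> sets S"
  shows "emeasure (P x) B = ennreal \<epsilon> * indicator C x * emeasure \<nu> B + emeasure (taboo x) B"
proof (cases "x \<in> C")
  case True
  interpret P: prob_space "P x" by (rule prob_space_P[OF x])
  interpret \<nu>: prob_space \<nu> by (rule prob_space_nu)
  show ?thesis
  proof (cases "\<epsilon> = 1")
    case [simp]: True
    \<comment> \<open>For \<epsilon> = 1 the minorization, applied to \<open>B\<close> and to its
      complement, forces \<open>P x = \<nu>\<close> because both have mass one.\<close>
    have "measure (P x) (space S - B) = 1 - measure (P x) B"
      "measure \<nu> (space S - B) = 1 - measure \<nu> B"
      using P.prob_compl[of B] \<nu>.prob_compl[of B] B
      by (simp_all add: sets_P[OF x] sets_nu sets_eq_imp_space_eq[OF sets_P[OF x]] space_nu)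
    with minorization[OF \<open>x \<in> C\<close> B] minorization[OF \<open>x \<in> C\<close>, of "space S - B"] B
    have "measure (P x) B = measure \<nu> B"
      by auto
    with \<open>x \<in> C\<close> show ?thesis
      unfolding taboo_def residual_def
      by (simp add: P.emeasure_eq_measure \<nu>.emeasure_eq_measure)
  next
    case False
    then have "\<epsilon> < 1" using eps by simp
    have "emeasure (residual P \<epsilon> \<nu> x) B = ennreal (inverse (1 - \<epsilon>) * (measure (P x) B - \<epsilon> * measure \<nu> B))"
      using minorization[OF \<open>x \<in> C\<close>] B False eps
      by (intro emeasure_residual P.prob_space_axioms \<nu>.prob_space_axioms)
         (auto simp: sets_P[OF x] sets_nu)
    moreover have inv: "(1 - \<epsilon>) * (inverse (1 - \<epsilon>) * y) = y" for y
      using False by simp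
    ultimately show ?thesis
      using \<open>\<epsilon> < 1\<close> \<open>x \<in> C\<close> minorization[OF \<open>x \<in> C\<close> B] eps
      by (simp add: inv taboo_def P.emeasure_eq_measure \<nu>.emeasure_eq_measure ennreal_mult'[symmetric]
          ennreal_plus[symmetric] del: ennreal_plus)
  qed
qed (simp add: taboo_def)

lemma nn_integral_P_eq_taboo:
  assumes x: "x \<in> space S" and f: "f \<in> borel_measurable S"
  shows "(\<integral>\<^sup>+y. f y \<partial>P x) = ennreal \<epsilon> * indicator C x * (\<integral>\<^sup>+y. f y \<partial>\<nu>) + (\<integral>\<^sup>+y. f y \<partial>taboo x)"
  using f x by (intro nn_integral_add_measure)
    (auto simp: sets_P sets_nu sets_taboo emeasure_P_eq_taboo cong: measurable_cong_sets)

text \<open>Total masses in the decomposition of \<open>P x\<close>. The mass \<epsilon> lost on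
  \<open>C\<close> is the probability that a visit to \<open>C\<close> carries the label
  \<open>True\<close>, that is, hits the atom.\<close>

lemma emeasure_taboo_space:
  assumes "x \<in> space S"
  shows "emeasure (taboo x) (space S) = ennreal (if x \<in> C then 1 - \<epsilon> else 1)"
proof -
  have "1 = ennreal \<epsilon> * indicator C x + emeasure (taboo x) (space S)"
    using emeasure_P_eq_taboo[OF assms sets.top] prob_space.emeasure_space_1[OF prob_space_nu]
      prob_space.emeasure_space_1[OF prob_space_P[OF assms]] sets_eq_imp_space_eq[OF sets_P[OF assms]]
    by (simp add: space_nu)
  then have "ennreal \<epsilon> * indicator C x + emeasure (taboo x) (space S) =
      ennreal \<epsilon> * indicator C x + ennreal (if x \<in> C then 1 - \<epsilon> else 1)"
    using eps by (simp add: ennreal_plus[symmetric] del: ennreal_plus)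
  then show ?thesis
    by (simp add: ennreal_add_left_cancel ennreal_mult_eq_top_iff indicator_def split: if_splits)
qed

lemma taboo_measurable [measurable]: "taboo \<in> S \<rightarrow>\<^sub>M subprob_algebra S"
proof (rule measurable_subprob_algebra)
  fix x assume x: "x \<in> space S"
  show "subprob_space (taboo x)"
    using emeasure_taboo_space[OF x] eps space_S sets_eq_imp_space_eq[OF sets_taboo[OF x]]
    by (intro subprob_spaceI) (auto simp: ennreal_le_1)
next
  fix B assume B [measurable]: "B \<in> sets S"
  interpret \<nu>: prob_space \<nu> by (rule prob_space_nu)
  \<comment> \<open>Measurability is read off from \<open>P - \<epsilon> I_C \<nu>\<close>; the
    subtraction is legitimate because the subtracted term is finite.\<close>
  have "(\<lambda>x. emeasure (P x) B - ennreal \<epsilon> * indicator C x * emeasure \<nu> B) \<in> borel_measurable S"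
    using measurable_emeasure_subprob_algebra[OF B] measurable_prob_algebraD[OF kernel]
    by measurable
  moreover have "emeasure (taboo x) B = emeasure (P x) B - ennreal \<epsilon> * indicator C x * emeasure \<nu> B"
    if "x \<in> space S" for x
    unfolding emeasure_P_eq_taboo[OF that B]
    by (simp add: \<nu>.emeasure_eq_measure ennreal_mult_eq_top_iff indicator_def)
  ultimately show "(\<lambda>x. emeasure (taboo x) B) \<in> borel_measurable S"
    by (simp cong: measurable_cong)
qed (rule sets_taboo)

section \<open>Iterates of the taboo kernel and the decomposition of \<pi>\<close>

primrec taboo_iter :: "'a measure \<Rightarrow> nat \<Rightarrow> 'a measure" where
  "taboo_iter \<mu> 0 = \<mu>"
| "taboo_iter \<mu> (Suc n) = taboo_iter \<mu> n \<bind> taboo"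

lemma taboo_iter_subprob:
  assumes "\<mu> \<in> space (prob_algebra S)"
  shows "subprob_space (taboo_iter \<mu> n) \<and> sets (taboo_iter \<mu> n) = sets S"
proof (induction n)
  case 0
  then show ?case
    using assms by (auto simp: space_prob_algebra prob_space_imp_subprob_space)
next
  case (Suc n)
  then have "taboo \<in> taboo_iter \<mu> n \<rightarrow>\<^sub>M subprob_algebra S"
    by (simp cong: measurable_cong_sets)
  moreover have sp: "space (taboo_iter \<mu> n) = space S"
    using Suc sets_eq_imp_space_eq by blast
  then have "sets (taboo_iter \<mu> n \<bind> taboo) = sets S"
    using space_S sets_taboo by (intro sets_bind) auto
  ultimately show ?case
    using Suc by (auto intro!: subprob_space_bind)
qed

lemmas subprob_space_taboo_iter = taboo_iter_subprob[THEN conjunct1]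
  and sets_taboo_iter = taboo_iter_subprob[THEN conjunct2]

lemma space_taboo_iter: "\<mu> \<in> space (prob_algebra S) \<Longrightarrow> space (taboo_iter \<mu> n) = space S"
  by (rule sets_eq_imp_space_eq[OF sets_taboo_iter])

lemma nn_integral_taboo_iter_Suc:
  assumes "\<mu> \<in> space (prob_algebra S)" "f \<in> borel_measurable S"
  shows "(\<integral>\<^sup>+x. f x \<partial>taboo_iter \<mu> (Suc n)) = (\<integral>\<^sup>+x. \<integral>\<^sup>+y. f y \<partial>taboo x \<partial>taboo_iter \<mu> n)"
  using assms(2) sets_taboo_iter[OF assms(1), of n]
  by (simp add: nn_integral_bind[where B=S] cong: measurable_cong_sets)

lemma emeasure_taboo_iter_Suc:
  assumes "\<mu> \<in> space (prob_algebra S)" "B \<in> sets S"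
  shows "emeasure (taboo_iter \<mu> (Suc n)) B = (\<integral>\<^sup>+x. emeasure (taboo x) B \<partial>taboo_iter \<mu> n)"
  using assms(2) sets_taboo_iter[OF assms(1), of n] space_taboo_iter[OF assms(1), of n] space_S
  by (simp add: emeasure_bind[where N=S] cong: measurable_cong_sets)

text \<open>One step of invariance splits \<open>\<pi>(f)\<close> into \<open>\<pi>(T f)\<close> and
  \<open>\<epsilon> \<pi>(C) \<nu>(f)\<close>. The induction hypothesis is applied to
  \<open>T f\<close>, hence the arbitrary \<open>f\<close>; this raises all indices by one, and the
  new term fills index 0.\<close>

lemma invariant_nn_integral_decomposition:
  assumes \<pi>: "invariant_prob S P \<pi>" and f: "f \<in> borel_measurable S"
  shows "(\<integral>\<^sup>+x. f x \<partial>\<pi>) = (\<integral>\<^sup>+x. f x \<partial>taboo_iter \<pi> n) +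
    ennreal \<epsilon> * emeasure \<pi> C * (\<Sum>t<n. \<integral>\<^sup>+x. f x \<partial>taboo_iter \<nu> t)"
  using f
proof (induction n arbitrary: f)
  case (Suc n)
  have \<pi>p: "\<pi> \<in> space (prob_algebra S)" and s [measurable_cong]: "sets \<pi> = sets S"
    using \<pi> by (auto simp: invariant_prob_def space_prob_algebra)
  note [measurable] = Suc.prems
  let ?T = "\<lambda>x. \<integral>\<^sup>+y. f y \<partial>taboo x"
  have T [measurable]: "?T \<in> borel_measurable S"
    by (rule measurable_compose[OF taboo_measurable nn_integral_measurable_subprob_algebra]) fact
  have "(\<integral>\<^sup>+x. f x \<partial>\<pi>) = (\<integral>\<^sup>+x. \<integral>\<^sup>+y. f y \<partial>P x \<partial>\<pi>)"
    by (rule invariant_prob_nn_integral[OF kernel \<pi> Suc.prems])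
  also have "\<dots> = (\<integral>\<^sup>+x. ennreal \<epsilon> * (\<integral>\<^sup>+y. f y \<partial>\<nu>) * indicator C x + ?T x \<partial>\<pi>)"
    by (rule nn_integral_cong)
       (simp add: sets_eq_imp_space_eq[OF s] nn_integral_P_eq_taboo[OF _ Suc.prems] mult_ac)
  also have "\<dots> = (\<integral>\<^sup>+x. ennreal \<epsilon> * (\<integral>\<^sup>+y. f y \<partial>\<nu>) * indicator C x \<partial>\<pi>) + (\<integral>\<^sup>+x. ?T x \<partial>\<pi>)"
    by (rule nn_integral_add) measurable
  also have "(\<integral>\<^sup>+x. ennreal \<epsilon> * (\<integral>\<^sup>+y. f y \<partial>\<nu>) * indicator C x \<partial>\<pi>) =
      ennreal \<epsilon> * emeasure \<pi> C * (\<integral>\<^sup>+y. f y \<partial>\<nu>)"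
    by (subst nn_integral_cmult_indicator) (simp_all add: s mult_ac)
  also have "(\<integral>\<^sup>+x. ?T x \<partial>\<pi>) = (\<integral>\<^sup>+x. f x \<partial>taboo_iter \<pi> (Suc n)) +
      ennreal \<epsilon> * emeasure \<pi> C * (\<Sum>t<n. \<integral>\<^sup>+x. f x \<partial>taboo_iter \<nu> (Suc t))"
    unfolding nn_integral_taboo_iter_Suc[OF \<pi>p Suc.prems]
      nn_integral_taboo_iter_Suc[OF nu_prob_algebra Suc.prems] by (rule Suc.IH[OF T])
  finally show ?case
    unfolding sum.lessThan_Suc_shift by (simp add: distrib_left add_ac del: taboo_iter.simps(2))
qed simp

lemma nn_integral_taboo_iter_le:
  assumes \<mu>: "\<mu> \<in> space (prob_algebra S)" and f [measurable]: "f \<in> borel_measurable S"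
    and drift: "\<And>x. x \<in> space S \<Longrightarrow> (\<integral>\<^sup>+y. f y \<partial>taboo x) \<le> c * f x"
  shows "(\<integral>\<^sup>+x. f x \<partial>taboo_iter \<mu> n) \<le> c ^ n * (\<integral>\<^sup>+x. f x \<partial>\<mu>)"
proof (induction n)
  case (Suc n)
  note [measurable_cong] = sets_taboo_iter[OF \<mu>, of n]
  have "(\<integral>\<^sup>+x. f x \<partial>taboo_iter \<mu> (Suc n)) \<le> (\<integral>\<^sup>+x. c * f x \<partial>taboo_iter \<mu> n)"
    unfolding nn_integral_taboo_iter_Suc[OF \<mu> f]
    using drift by (intro nn_integral_mono) (simp add: space_taboo_iter[OF \<mu>])
  also have "\<dots> = c * (\<integral>\<^sup>+x. f x \<partial>taboo_iter \<mu> n)"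
    by (rule nn_integral_cmult) measurable
  also have "\<dots> \<le> c * (c ^ n * (\<integral>\<^sup>+x. f x \<partial>\<mu>))"
    by (rule mult_left_mono[OF Suc.IH]) simp
  finally show ?case
    by (simp add: mult.assoc)
qed simp

text \<open>Let r be the mass of \<open>\<pi> T^M\<close> and q the normalised sum at
  \<open>B\<close>. The decomposition on the whole space gives \<open>1 = r + c * Z\<close>, and on
  \<open>B\<close> it gives \<open>\<pi>(B) = \<pi> T^M(B) + c * Z * q\<close>. Hence
  \<open>\<pi>(B) - q = \<pi> T^M(B) - r * q\<close>, a difference of two numbers in [0, r].\<close>

lemma abs_measure_diff_truncated_mixture_le:
  assumes \<pi>: "invariant_prob S P \<pi>" and M: "0 < M" and B: "B \<in> sets S"
  shows "\<bar>measure \<pi> B - (\<Sum>n<M. measure (taboo_iter \<nu> n) B) / (\<Sum>n<M. measure (taboo_iter \<nu> n) (space S))\<bar>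
    \<le> measure (taboo_iter \<pi> M) (space S)"
proof -
  have \<pi>p: "\<pi> \<in> space (prob_algebra S)" and s: "sets \<pi> = sets S" and "prob_space \<pi>"
    using \<pi> by (auto simp: invariant_prob_def space_prob_algebra)
  interpret \<pi>: prob_space \<pi> by fact
  have fin: "finite_measure (taboo_iter \<mu> n)" if "\<mu> \<in> space (prob_algebra S)" for \<mu> n
    using subprob_space_taboo_iter[OF that] by (rule subprob_space.axioms(1))
  have le: "measure (taboo_iter \<mu> n) B \<le> measure (taboo_iter \<mu> n) (space S)"
    if "\<mu> \<in> space (prob_algebra S)" for \<mu> n
    using finite_measure.bounded_measure[OF fin[OF that], of n B] by (simp add: space_taboo_iter[OF that])
  define c where "c = \<epsilon> * measure \<pi> C"
  define Z where "Z = (\<Sum>n<M. measure (taboo_iter \<nu> n) (space S))"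
  have decomp: "measure \<pi> D = measure (taboo_iter \<pi> M) D + c * (\<Sum>n<M. measure (taboo_iter \<nu> n) D)"
    if D: "D \<in> sets S" for D
  proof -
    have "ennreal (measure \<pi> D) = emeasure \<pi> D"
      by (simp add: \<pi>.emeasure_eq_measure)
    also have "\<dots> = emeasure (taboo_iter \<pi> M) D +
        ennreal \<epsilon> * emeasure \<pi> C * (\<Sum>n<M. emeasure (taboo_iter \<nu> n) D)"
      using invariant_nn_integral_decomposition[OF \<pi>, of "indicator D" M] D
      by (simp add: s sets_taboo_iter[OF \<pi>p] sets_taboo_iter[OF nu_prob_algebra])
    also have "\<dots> = ennreal (measure (taboo_iter \<pi> M) D + c * (\<Sum>n<M. measure (taboo_iter \<nu> n) D))"
      using eps
      by (simp add: finite_measure.emeasure_eq_measure[OF fin[OF \<pi>p]] \<pi>.emeasure_eq_measure c_def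
          finite_measure.emeasure_eq_measure[OF fin[OF nu_prob_algebra]] sum_nonneg ennreal_mult'[symmetric]
          ennreal_plus[symmetric] del: ennreal_plus)
    finally show ?thesis
      using eps by (subst (asm) ennreal_inj) (auto simp: c_def intro!: add_nonneg_nonneg mult_nonneg_nonneg sum_nonneg)
  qed
  \<comment> \<open>The term of index 0 alone, present since \<open>M > 0\<close>, bounds the
    normaliser away from zero.\<close>
  have "measure (taboo_iter \<nu> 0) (space S) = 1"
    using prob_space.prob_space[OF prob_space_nu] by (simp add: space_nu)
  moreover have "measure (taboo_iter \<nu> 0) (space S) \<le> Z"
    unfolding Z_def using M by (intro member_le_sum) auto
  ultimately have "1 \<le> Z" by simp
  define q where "q = (\<Sum>n<M. measure (taboo_iter \<nu> n) B) / Z"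
  have q: "0 \<le> q" "q \<le> 1" "(\<Sum>n<M. measure (taboo_iter \<nu> n) B) = Z * q"
    using \<open>1 \<le> Z\<close> le[OF nu_prob_algebra]
    by (auto simp: q_def sum_nonneg intro!: divide_nonneg_nonneg)
       (auto simp: Z_def intro!: sum_mono)
  have r: "1 = measure (taboo_iter \<pi> M) (space S) + c * Z"
    using decomp[of "space S"] \<pi>.prob_space by (simp add: Z_def sets_eq_imp_space_eq[OF s])
  have "measure \<pi> B - q = measure (taboo_iter \<pi> M) B - measure (taboo_iter \<pi> M) (space S) * q"
  proof -
    have "measure \<pi> B = measure (taboo_iter \<pi> M) B + (c * Z) * q"
      using decomp[OF B] q(3) by simp
    also have "c * Z = 1 - measure (taboo_iter \<pi> M) (space S)"
      using r by simp
    finally show ?thesis by (simp add: algebra_simps)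
  qed
  moreover have "0 \<le> measure (taboo_iter \<pi> M) (space S) * q"
    "measure (taboo_iter \<pi> M) (space S) * q \<le> measure (taboo_iter \<pi> M) (space S)"
    using q by (auto simp: mult_right_le_one_le)
  ultimately have "\<bar>measure \<pi> B - q\<bar> \<le> measure (taboo_iter \<pi> M) (space S)"
    using le[OF \<pi>p, of M] measure_nonneg[of "taboo_iter \<pi> M" B] by linarith
  then show ?thesis
    by (simp add: q_def Z_def)
qed

text \<open>Measurability is inherited from \<open>taboo\<close> by undoing the factor
  \<open>1 - \<epsilon>\<close> on \<open>C\<close>. At \<epsilon> = 1 this still holds, since
  \<open>inverse 0 = 0\<close> and the residual is null.\<close>

lemma residual_measurable:
  assumes B: "B \<in> sets S"
  shows "(\<lambda>x. if x \<in> C then emeasure (residual P \<epsilon> \<nu> x) B else emeasure (P x) B) \<in> borel_measurable S"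
proof -
  have [measurable]: "(\<lambda>x. emeasure (taboo x) B) \<in> borel_measurable S"
    using taboo_measurable by (rule measurable_compose[OF _ measurable_emeasure_subprob_algebra[OF B]])
  have "emeasure (residual P \<epsilon> \<nu> x) B = ennreal (inverse (1 - \<epsilon>)) * emeasure (taboo x) B" if "x \<in> C" for x
  proof (cases "\<epsilon> = 1")
    case True
    then show ?thesis
      unfolding taboo_def residual_def by simp
  next
    case False
    then show ?thesis
      using that eps by (simp add: taboo_def mult.assoc[symmetric] ennreal_mult'[symmetric])
  qed
  then have "(\<lambda>x. if x \<in> C then emeasure (residual P \<epsilon> \<nu> x) B else emeasure (P x) B) =
      (\<lambda>x. if x \<in> C then ennreal (inverse (1 - \<epsilon>)) * emeasure (taboo x) B else emeasure (taboo x) B)"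
    by (auto simp: taboo_def)
  also have "\<dots> \<in> borel_measurable S"
    by measurable
  finally show ?thesis .
qed

end

section \<open>Excursions of the split chain\<close>

locale split_chain = minorized_kernel S P C \<epsilon> \<nu>
  for S :: "'a measure" and P C \<epsilon> \<nu> +
  fixes \<Omega> :: "'w measure" and Y :: "nat \<Rightarrow> 'w \<Rightarrow> 'a \<times> bool"
  assumes chain: "markov_chain \<Omega> (split_space S) (split_kernel P C \<epsilon> \<nu>) Y"
begin

lemma Y_measurable [measurable]: "Y n \<in> \<Omega> \<rightarrow>\<^sub>M split_space S"
  using chain by (simp add: markov_chain_def)

lemma fst_Y_measurable [measurable]: "(\<lambda>\<omega>. fst (Y n \<omega>)) \<in> \<Omega> \<rightarrow>\<^sub>M S"
  using Y_measurable[of n] unfolding split_space_def by (rule measurable_compose[OF _ measurable_fst])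

lemma snd_Y_measurable [measurable]: "(\<lambda>\<omega>. snd (Y n \<omega>)) \<in> \<Omega> \<rightarrow>\<^sub>M count_space UNIV"
  using Y_measurable[of n] unfolding split_space_def by (rule measurable_compose[OF _ measurable_snd])

lemma atom_sets [measurable]: "atom C \<in> sets (split_space S)"
  unfolding atom_def split_space_def by measurable

text \<open>In terms of the return time this is the start in the atom together with
  \<open>\<tau>_\<alpha> \<ge> n + 1\<close>; index 0 is the bare starting event.\<close>

definition excursion :: "nat \<Rightarrow> 'w set" where
  "excursion n = {\<omega> \<in> space \<Omega>. Y 0 \<omega> \<in> atom C \<and> (\<forall>s\<in>{1..n}. Y s \<omega> \<notin> atom C)}"

lemma excursion_sets [measurable]: "excursion n \<in> sets \<Omega>"
  unfolding excursion_def by measurable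

lemma emeasure_excursion_next:
  assumes B: "B \<in> sets S"
  shows "emeasure \<Omega> {\<omega> \<in> excursion n. Y (Suc n) \<omega> \<in> B \<times> {d}} =
    (\<integral>\<^sup>+ \<omega> \<in> excursion n. emeasure (split_kernel P C \<epsilon> \<nu> (Y n \<omega>)) (B \<times> {d}) \<partial>\<Omega>)"
proof -
  \<comment> \<open>The excursion as a set of histories up to time \<open>n\<close>, the form in
    which the Markov property is available.\<close>
  define D where "D = {h \<in> space (PiM {..n} (\<lambda>_. split_space S)).
      h 0 \<in> atom C \<and> (\<forall>s\<in>{1..n}. h s \<notin> atom C)}"
  have [measurable]: "(\<lambda>h. h s) \<in> PiM {..n} (\<lambda>_. split_space S) \<rightarrow>\<^sub>M split_space S" if "s \<le> n" for s
    using that by (intro measurable_component_singleton) simp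
  have D: "D \<in> sets (PiM {..n} (\<lambda>_. split_space S))"
    unfolding D_def by measurable
  have "B \<times> {d} \<in> sets (split_space S)"
    using B unfolding split_space_def by measurable
  with D chain have "emeasure \<Omega> {\<omega> \<in> space \<Omega>. (\<lambda>i\<in>{..n}. Y i \<omega>) \<in> D \<and> Y (Suc n) \<omega> \<in> B \<times> {d}} =
      (\<integral>\<^sup>+ \<omega> \<in> {\<omega> \<in> space \<Omega>. (\<lambda>i\<in>{..n}. Y i \<omega>) \<in> D}. emeasure (split_kernel P C \<epsilon> \<nu> (Y n \<omega>)) (B \<times> {d}) \<partial>\<Omega>)"
    unfolding markov_chain_def by blast
  moreover have "(\<lambda>i\<in>{..n}. Y i \<omega>) \<in> D \<longleftrightarrow> \<omega> \<in> excursion n" if "\<omega> \<in> space \<Omega>" for \<omega>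
    using that measurable_space[OF Y_measurable that] by (auto simp: D_def excursion_def space_PiM PiE_iff)
  then have "{\<omega> \<in> space \<Omega>. (\<lambda>i\<in>{..n}. Y i \<omega>) \<in> D} = excursion n"
    "{\<omega> \<in> space \<Omega>. (\<lambda>i\<in>{..n}. Y i \<omega>) \<in> D \<and> Y (Suc n) \<omega> \<in> B \<times> {d}} = {\<omega> \<in> excursion n. Y (Suc n) \<omega> \<in> B \<times> {d}}"
    by (auto simp: excursion_def)
  ultimately show ?thesis by simp
qed

definition level_weight :: "bool \<Rightarrow> ennreal" where
  "level_weight d = ennreal (\<epsilon> * of_bool d + (1 - \<epsilon>) * (1 - of_bool d))"

lemma level_weight_sum: "level_weight True * z + level_weight False * z = z"
  using eps by (simp add: level_weight_def distrib_right[symmetric] ennreal_plus[symmetric] del: ennreal_plus)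

lemma emeasure_split_kernel_Times:
  assumes "fst y \<in> space S" "B \<in> sets S"
  shows "emeasure (split_kernel P C \<epsilon> \<nu> y) (B \<times> {d}) = level_weight d *
    (if fst y \<notin> C then emeasure (P (fst y)) B
     else if snd y then emeasure \<nu> B else emeasure (residual P \<epsilon> \<nu> (fst y)) B)"
  using emeasure_split_kernel[of P "fst y" S \<nu> B \<epsilon> C "snd y" d] assms eps sets_P sets_nu
  by (simp add: level_weight_def)

lemma fst_Y_space: "\<omega> \<in> space \<Omega> \<Longrightarrow> fst (Y n \<omega>) \<in> space S"
  using measurable_space[OF fst_Y_measurable] by blast

text \<open>Each new label is Bernoulli(\<epsilon>) independently of the new position, so its weight
  factors out. The label stays in the statement because the next transition depends on it. On
  \<open>C\<close>, label \<open>True\<close> ends the excursion, while label \<open>False\<close>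
  has weight \<open>1 - \<epsilon>\<close> and moves by the residual; averaging over labels thus
  produces \<open>taboo\<close>.\<close>

lemma excursion_law_level:
  assumes "B \<in> sets S"
  shows "emeasure \<Omega> {\<omega> \<in> excursion n. Y (Suc n) \<omega> \<in> B \<times> {d}} =
    emeasure \<Omega> (excursion 0) * level_weight d * emeasure (taboo_iter \<nu> n) B"
  using assms
proof (induction n arbitrary: B d)
  case 0
  \<comment> \<open>From the atom the position moves by \<nu> wherever in \<open>C\<close> the chain
    started, so the integrand is constant on the event.\<close>
  have "(\<integral>\<^sup>+ \<omega> \<in> excursion 0. emeasure (split_kernel P C \<epsilon> \<nu> (Y 0 \<omega>)) (B \<times> {d}) \<partial>\<Omega>) =
      (\<integral>\<^sup>+ \<omega>. level_weight d * emeasure \<nu> B * indicator (excursion 0) \<omega> \<partial>\<Omega>)"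
    using 0 fst_Y_space
    by (intro nn_integral_cong)
       (auto simp: emeasure_split_kernel_Times excursion_def atom_def indicator_def)
  also have "\<dots> = level_weight d * emeasure \<nu> B * emeasure \<Omega> (excursion 0)"
    by (rule nn_integral_cmult_indicator) simp
  finally show ?case
    by (simp only: emeasure_excursion_next[OF 0] taboo_iter.simps mult_ac)
next
  case (Suc n)
  let ?p = "emeasure \<Omega> (excursion 0)" and ?\<mu> = "taboo_iter \<nu> n"
  note [measurable_cong] = sets_taboo_iter[OF nu_prob_algebra, of n]
  \<comment> \<open>\<open>G\<close> is the transition out of a state off the atom;
    \<open>H e\<close> also kills the states that lie in the atom when the label is
    \<open>e\<close>.\<close>
  define G where "G x = (if x \<in> C then emeasure (residual P \<epsilon> \<nu> x) B else emeasure (P x) B)" for x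
  define H where "H e x = (if e \<and> x \<in> C then 0 else G x)" for e x
  have [measurable]: "G \<in> borel_measurable S"
    unfolding G_def by (rule residual_measurable[OF Suc.prems])
  have H [measurable]: "H e \<in> borel_measurable S" for e
    unfolding H_def by measurable
  define F where "F e = {\<omega> \<in> excursion n. snd (Y (Suc n) \<omega>) = e}" for e
  have F [measurable]: "F e \<in> sets \<Omega>" for e
    unfolding F_def excursion_def by measurable
  \<comment> \<open>The induction hypothesis as an equality of measures: restricted to the excursion
    with label \<open>e\<close>, the position has law proportional to \<open>\<nu> T^n\<close>.
    Integrals over \<Omega> thereby become integrals over the state space.\<close>
  have law: "distr (density \<Omega> (indicator (F e))) S (\<lambda>\<omega>. fst (Y (Suc n) \<omega>)) =
      scale_measure (?p * level_weight e) ?\<mu>" for e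
  proof (rule measure_eqI)
    fix A assume "A \<in> sets (distr (density \<Omega> (indicator (F e))) S (\<lambda>\<omega>. fst (Y (Suc n) \<omega>)))"
    then have A [measurable]: "A \<in> sets S" by simp
    let ?A = "(\<lambda>\<omega>. fst (Y (Suc n) \<omega>)) -` A \<inter> space \<Omega>"
    have "emeasure (distr (density \<Omega> (indicator (F e))) S (\<lambda>\<omega>. fst (Y (Suc n) \<omega>))) A =
        (\<integral>\<^sup>+\<omega>. indicator (F e) \<omega> * indicator ?A \<omega> \<partial>\<Omega>)"
      by (simp add: emeasure_distr emeasure_density)
    also have "\<dots> = emeasure \<Omega> (F e \<inter> ?A)"
      by (simp add: indicator_inter_arith[symmetric])
    also have "F e \<inter> ?A = {\<omega> \<in> excursion n. Y (Suc n) \<omega> \<in> A \<times> {e}}"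
      by (auto simp: F_def excursion_def mem_Times_iff)
    finally show "emeasure (distr (density \<Omega> (indicator (F e))) S (\<lambda>\<omega>. fst (Y (Suc n) \<omega>))) A =
        emeasure (scale_measure (?p * level_weight e) ?\<mu>) A"
      by (simp add: Suc.IH[OF A])
  qed (simp add: sets_taboo_iter[OF nu_prob_algebra])
  have part: "(\<integral>\<^sup>+\<omega>. indicator (F e) \<omega> * H e (fst (Y (Suc n) \<omega>)) \<partial>\<Omega>) =
      ?p * level_weight e * (\<integral>\<^sup>+x. H e x \<partial>?\<mu>)" for e
  proof -
    have "(\<integral>\<^sup>+\<omega>. indicator (F e) \<omega> * H e (fst (Y (Suc n) \<omega>)) \<partial>\<Omega>) =
        (\<integral>\<^sup>+x. H e x \<partial>distr (density \<Omega> (indicator (F e))) S (\<lambda>\<omega>. fst (Y (Suc n) \<omega>)))"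
      by (simp add: nn_integral_distr nn_integral_density)
    also have "\<dots> = ?p * level_weight e * (\<integral>\<^sup>+x. H e x \<partial>?\<mu>)"
      unfolding law by (rule nn_integral_scale_measure) measurable
    finally show ?thesis .
  qed
  have "emeasure \<Omega> {\<omega> \<in> excursion (Suc n). Y (Suc (Suc n)) \<omega> \<in> B \<times> {d}} =
      (\<integral>\<^sup>+ \<omega> \<in> excursion (Suc n). emeasure (split_kernel P C \<epsilon> \<nu> (Y (Suc n) \<omega>)) (B \<times> {d}) \<partial>\<Omega>)"
    by (rule emeasure_excursion_next[OF Suc.prems])
  also have "\<dots> = (\<integral>\<^sup>+ \<omega>. level_weight d * (indicator (F True) \<omega> * H True (fst (Y (Suc n) \<omega>)) +
      indicator (F False) \<omega> * H False (fst (Y (Suc n) \<omega>))) \<partial>\<Omega>)"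
  proof (rule nn_integral_cong)
    fix \<omega> assume \<omega>: "\<omega> \<in> space \<Omega>"
    have "\<omega> \<in> excursion (Suc n) \<longleftrightarrow> \<omega> \<in> excursion n \<and> Y (Suc n) \<omega> \<notin> atom C"
      by (auto simp: excursion_def atLeastAtMostSuc_conv)
    moreover have "Y (Suc n) \<omega> \<in> atom C \<longleftrightarrow> fst (Y (Suc n) \<omega>) \<in> C \<and> snd (Y (Suc n) \<omega>)"
      by (auto simp: atom_def mem_Times_iff)
    ultimately show "emeasure (split_kernel P C \<epsilon> \<nu> (Y (Suc n) \<omega>)) (B \<times> {d}) * indicator (excursion (Suc n)) \<omega> =
        level_weight d * (indicator (F True) \<omega> * H True (fst (Y (Suc n) \<omega>)) +
        indicator (F False) \<omega> * H False (fst (Y (Suc n) \<omega>)))"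
      using fst_Y_space[OF \<omega>, of "Suc n"] Suc.prems
      by (auto simp: emeasure_split_kernel_Times F_def H_def G_def indicator_def)
  qed
  also have "\<dots> = level_weight d * ((\<integral>\<^sup>+\<omega>. indicator (F True) \<omega> * H True (fst (Y (Suc n) \<omega>)) \<partial>\<Omega>) +
      (\<integral>\<^sup>+\<omega>. indicator (F False) \<omega> * H False (fst (Y (Suc n) \<omega>)) \<partial>\<Omega>))"
    by (subst nn_integral_cmult) (simp_all add: nn_integral_add)
  also have "\<dots> = ?p * level_weight d *
      (\<integral>\<^sup>+x. level_weight True * H True x + level_weight False * H False x \<partial>?\<mu>)"
  proof -
    have "(\<integral>\<^sup>+x. level_weight True * H True x + level_weight False * H False x \<partial>?\<mu>) =
        level_weight True * (\<integral>\<^sup>+x. H True x \<partial>?\<mu>) + level_weight False * (\<integral>\<^sup>+x. H False x \<partial>?\<mu>)"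
      by (simp add: nn_integral_add nn_integral_cmult)
    then show ?thesis
      unfolding part by (simp only: distrib_left mult_ac)
  qed
  \<comment> \<open>Averaging the labels: off \<open>C\<close> the weights add up to one and leave
    \<open>P\<close>; on \<open>C\<close> only \<open>(1 - \<epsilon>)\<close> times the residual
    survives.\<close>
  also have "(\<integral>\<^sup>+x. level_weight True * H True x + level_weight False * H False x \<partial>?\<mu>) =
      (\<integral>\<^sup>+x. emeasure (taboo x) B \<partial>?\<mu>)"
    using level_weight_sum by (intro nn_integral_cong) (auto simp: H_def G_def taboo_def level_weight_def)
  also have "\<dots> = emeasure (taboo_iter \<nu> (Suc n)) B"
    by (rule emeasure_taboo_iter_Suc[OF nu_prob_algebra Suc.prems, symmetric])
  finally show ?case .
qed

lemma excursion_law: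
  assumes [measurable]: "B \<in> sets S"
  shows "emeasure \<Omega> {\<omega> \<in> excursion n. fst (Y (Suc n) \<omega>) \<in> B} =
    emeasure \<Omega> (excursion 0) * emeasure (taboo_iter \<nu> n) B"
proof -
  let ?A = "\<lambda>d. {\<omega> \<in> excursion n. Y (Suc n) \<omega> \<in> B \<times> {d}}"
  have "{\<omega> \<in> excursion n. fst (Y (Suc n) \<omega>) \<in> B} = ?A True \<union> ?A False"
    by (auto simp: mem_Times_iff)
  moreover have "?A d = excursion n \<inter> {\<omega> \<in> space \<Omega>. fst (Y (Suc n) \<omega>) \<in> B \<and> snd (Y (Suc n) \<omega>) = d}" for d
    by (auto simp: excursion_def mem_Times_iff)
  then have "?A d \<in> sets \<Omega>" for d
    by simp
  then have "emeasure \<Omega> (?A True \<union> ?A False) = emeasure \<Omega> (?A True) + emeasure \<Omega> (?A False)"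
    by (intro plus_emeasure[symmetric]) auto
  ultimately show ?thesis
    using level_weight_sum[of "emeasure \<Omega> (excursion 0) * emeasure (taboo_iter \<nu> n) B"]
    by (simp add: excursion_law_level[OF assms] mult_ac)
qed

text \<open>Given the start, the event \<open>\<tau>_\<alpha> \<ge> n + 1\<close> with position in
  \<open>B\<close> has probability \<open>\<nu> T^n(B)\<close>. In the product of \<open>Q_t\<close>
  and \<open>p_tilde\<close> the probability of the conditioning event cancels, leaving
  \<open>\<nu> T^(t-1)(B) / Z\<close>.\<close>

lemma measure_pi_tilde:
  assumes B [measurable]: "B \<in> sets S" and start: "0 < measure \<Omega> (excursion 0)"
  shows "measure (pi_tilde S \<Omega> Y (atom C) M) B =
    (\<Sum>n<M. measure (taboo_iter \<nu> n) B) / (\<Sum>n<M. measure (taboo_iter \<nu> n) (space S))"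
proof -
  interpret \<Omega>: prob_space \<Omega>
    using chain by (simp add: markov_chain_def)
  have fin: "emeasure (taboo_iter \<nu> n) A = ennreal (measure (taboo_iter \<nu> n) A)" for n A
    using subprob_space_taboo_iter[OF nu_prob_algebra]
    by (intro finite_measure.emeasure_eq_measure subprob_space.axioms(1))
  let ?E0 = "{\<omega> \<in> space \<Omega>. Y 0 \<omega> \<in> atom C}"
  let ?N = "no_return_before \<Omega> Y (atom C)"
  let ?I = "start_in \<Omega> Y (atom C)"
  let ?p = "measure \<Omega> (excursion 0)"
  let ?m = "\<lambda>n. measure (taboo_iter \<nu> n) (space S)"
  let ?Z = "\<Sum>n<M. ?m n"
  have E0 [measurable]: "?E0 \<in> sets \<Omega>" by measurable
  have e0: "excursion 0 = ?E0" by (simp add: excursion_def)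
  \<comment> \<open>Time \<open>t = n + 1\<close> corresponds to \<open>n\<close> taboo steps: no
    return before \<open>t\<close> constrains the times 1 to \<open>n\<close> only.\<close>
  have N: "?N (Suc n) = {\<omega> \<in> space \<Omega>. \<forall>s\<in>{1..n}. Y s \<omega> \<notin> atom C}" for n
    by (auto simp: no_return_before_def return_time_def le_INF_iff not_less_eq_eq)
  then have N_sets [measurable]: "?N (Suc n) \<in> sets \<Omega>" for n
    by simp
  have sI [measurable_cong]: "sets ?I = sets \<Omega>"
    by (simp add: start_in_def)
  have I: "emeasure ?I (?N (Suc n) \<inter> {\<omega> \<in> space \<Omega>. fst (Y (Suc n) \<omega>) \<in> A}) =
      ennreal (measure (taboo_iter \<nu> n) A)" if [measurable]: "A \<in> sets S" for A n
  proof -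
    have "?E0 \<inter> (?N (Suc n) \<inter> {\<omega> \<in> space \<Omega>. fst (Y (Suc n) \<omega>) \<in> A}) =
        {\<omega> \<in> excursion n. fst (Y (Suc n) \<omega>) \<in> A}"
      by (auto simp: N excursion_def)
    moreover have "emeasure \<Omega> {\<omega> \<in> excursion n. fst (Y (Suc n) \<omega>) \<in> A} =
        ennreal (?p * measure (taboo_iter \<nu> n) A)"
      unfolding excursion_law[OF that] by (simp add: fin \<Omega>.emeasure_eq_measure ennreal_mult')
    ultimately have "emeasure ?I (?N (Suc n) \<inter> {\<omega> \<in> space \<Omega>. fst (Y (Suc n) \<omega>) \<in> A}) =
        ennreal (?p * measure (taboo_iter \<nu> n) A) / ennreal ?p"
      unfolding start_in_def
      by (subst emeasure_uniform_measure)
         (simp_all add: e0[symmetric] \<Omega>.emeasure_eq_measure)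
    then show ?thesis
      using start by (simp add: divide_ennreal)
  qed
  have IN: "emeasure ?I (?N (Suc n)) = ennreal (?m n)" for n
  proof -
    have "?N (Suc n) \<inter> {\<omega> \<in> space \<Omega>. fst (Y (Suc n) \<omega>) \<in> space S} = ?N (Suc n)"
      using fst_Y_space by (auto simp: N)
    then show ?thesis
      using I[OF sets.top, of n] by simp
  qed
  then have mIN: "measure ?I (?N (Suc n)) = ?m n" for n
    by (simp add: measure_def)
  have shift: "(\<Sum>t = 1..M. h t) = (\<Sum>n<M. h (Suc n))" for h :: "nat \<Rightarrow> 'b::comm_monoid_add"
    by (simp add: sum.shift_bounds_cl_Suc_ivl[of h 0 "M - 1", symmetric] lessThan_atLeast0
        atLeastLessThanSuc_atLeastAtMost[symmetric] sum.shift_bounds_Suc_ivl[of h 0 M, symmetric])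
  have p: "p_tilde \<Omega> Y (atom C) M (Suc n) = ?m n / ?Z" for n
    unfolding p_tilde_def shift by (simp add: mIN)
  have Q: "emeasure (Q_law S \<Omega> Y (atom C) (Suc n)) B * ennreal (p_tilde \<Omega> Y (atom C) M (Suc n)) =
      ennreal (measure (taboo_iter \<nu> n) B / ?Z)" for n
  \<comment> \<open>If the conditioning event is null then \<open>Q_t\<close> has no meaning, but
    its weight is zero and so is \<open>\<nu> T^n(B)\<close>.\<close>
  proof (cases "?m n = 0")
    case True
    then have "measure (taboo_iter \<nu> n) B = 0"
      using finite_measure.bounded_measure[OF subprob_space.axioms(1)[OF subprob_space_taboo_iter[OF nu_prob_algebra]], of n B]
      by (simp add: space_taboo_iter[OF nu_prob_algebra] measure_le_0_iff)
    with True show ?thesis by (simp add: p)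
  next
    case False
    then have pos: "0 < ?m n"
      by (simp add: zero_less_measure_iff)
    have "emeasure (Q_law S \<Omega> Y (atom C) (Suc n)) B =
        emeasure (uniform_measure ?I (?N (Suc n))) {\<omega> \<in> space \<Omega>. fst (Y (Suc n) \<omega>) \<in> B}"
    proof -
      have "(\<lambda>\<omega>. fst (Y (Suc n) \<omega>)) -` B \<inter> space \<Omega> = {\<omega> \<in> space \<Omega>. fst (Y (Suc n) \<omega>) \<in> B}"
        by auto
      then show ?thesis
        unfolding Q_law_def by (subst emeasure_distr) (simp_all add: sets_eq_imp_space_eq[OF sI])
    qed
    also have "\<dots> = ennreal (measure (taboo_iter \<nu> n) B) / ennreal (?m n)"
      by (subst emeasure_uniform_measure) (simp_all add: I IN)
    also have "\<dots> = ennreal (measure (taboo_iter \<nu> n) B / ?m n)"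
      using pos by (simp add: divide_ennreal)
    finally show ?thesis
      using pos by (simp add: p ennreal_mult'[symmetric])
  qed
  have "emeasure (pi_tilde S \<Omega> Y (atom C) M) B = (\<Sum>n<M. ennreal (measure (taboo_iter \<nu> n) B / ?Z))"
    unfolding emeasure_pi_tilde[OF B] shift Q ..
  also have "\<dots> = ennreal ((\<Sum>n<M. measure (taboo_iter \<nu> n) B) / ?Z)"
    by (simp add: sum_nonneg sum_divide_distrib)
  finally show ?thesis
    by (simp add: measure_def sum_nonneg)
qed

end

section \<open>Geometric contraction of the taboo kernel\<close>

lemma phi_gt_0: "0 < phi lam \<beta>" if "0 < lam" "lam < 1" "1 < \<beta>"
  using that by (simp add: phi_def ln_inverse divide_pos_neg)

text \<open>The identity for which the exponent is chosen: it turns the drift factor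
  \<open>lam\<close> of \<open>V\<close> into the factor \<open>1/\<beta>\<close> for
  \<open>V^\<phi>\<close>.\<close>

lemma lam_powr_phi: "lam powr phi lam \<beta> = inverse \<beta>" if "0 < lam" "lam < 1" "1 < \<beta>"
proof -
  have "phi lam \<beta> * ln lam = - ln \<beta>"
    using that by (simp add: phi_def ln_inverse)
  then show ?thesis
    using that by (simp add: powr_def exp_minus)
qed

text \<open>In logarithms the second claim reads \<open>\<phi> * (ln J - ln (1 - \<epsilon>)) < - ln
  (1 - \<epsilon>)\<close>. For \<open>J \<ge> 1\<close> this is the bound on \<beta> itself, and
  the resulting threshold for \<phi> is at most 1. For \<open>J < 1\<close> the bound gives
  \<open>\<phi> < 1\<close>, and then \<open>\<phi> * ln J\<close> and
  \<open>(1 - \<phi>) * ln (1 - \<epsilon>)\<close> are both negative.\<close>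

lemma beta_star_imp:
  assumes eps: "0 < \<epsilon>" "\<epsilon> < 1" and a: "\<epsilon> < a" and lam: "0 < lam" "lam < 1" and \<beta>: "1 < \<beta>"
    and less: "\<beta> < beta_star (ennreal a) \<epsilon> lam"
  defines "J \<equiv> (a - \<epsilon>) / lam"
  shows "phi lam \<beta> < 1" "(1 - \<epsilon>) * (J / (1 - \<epsilon>)) powr phi lam \<beta> < 1"
proof -
  have J: "0 < J"
    using a lam by (simp add: J_def)
  have Jc: "J_const (ennreal a) \<epsilon> lam = J"
    using a eps by (simp add: J_const_def J_def)
  let ?l = "ln (inverse lam)" and ?q = "ln (1 - \<epsilon>)"
  have l: "0 < ?l" and q: "?q < 0"
    using lam eps by (auto simp: ln_inverse)
  have "phi lam \<beta> < 1 \<and> phi lam \<beta> * (ln J - ?q) < - ?q"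
  proof (cases "J < 1")
    case True
    then have "\<beta> < inverse lam"
      using less by (simp add: beta_star_def Jc)
    then have "phi lam \<beta> < 1"
      using \<beta> lam l by (simp add: phi_def del: ln_inverse)
    moreover have "phi lam \<beta> * ln J < 0"
      using True J phi_gt_0[OF lam \<beta>] by (simp add: mult_pos_neg)
    moreover have "(1 - phi lam \<beta>) * ?q < 0"
      using \<open>phi lam \<beta> < 1\<close> q by (intro mult_pos_neg) auto
    ultimately show ?thesis
      by (simp add: algebra_simps)
  next
    case False
    then have lnJ: "0 \<le> ln J" by simp
    have "ln \<beta> < ln (beta_star (ennreal a) \<epsilon> lam)"
      using less \<beta> by simp
    also have "\<dots> = ?l * (- ?q) / (ln J - ?q)"
      using False eps lam by (simp add: beta_star_def Jc ln_inverse)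
    finally have less': "phi lam \<beta> < - ?q / (ln J - ?q)"
      using l by (simp add: phi_def field_simps del: ln_inverse)
    also have "\<dots> \<le> 1"
      using lnJ q by (subst divide_le_eq_1_pos) auto
    finally show ?thesis
      using less' lnJ q by (subst (asm) pos_less_divide_eq) auto
  qed
  then have *: "phi lam \<beta> < 1" "phi lam \<beta> * (ln J - ?q) < - ?q" by auto
  show "phi lam \<beta> < 1" by (fact *)
  have "(1 - \<epsilon>) * (J / (1 - \<epsilon>)) powr phi lam \<beta> = exp (?q + phi lam \<beta> * (ln J - ?q))"
    using J eps by (simp add: powr_def exp_add ln_div)
  also have "\<dots> < 1"
    using *(2) by simp
  finally show "(1 - \<epsilon>) * (J / (1 - \<epsilon>)) powr phi lam \<beta> < 1" .
qed

context minorized_kernel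
begin

text \<open>Jensen's inequality is applied off \<open>C\<close> to \<open>P x\<close>, with mass 1
  and mean at most \<open>lam * V x\<close>, and on \<open>C\<close> to \<open>taboo x\<close>, with
  mass \<open>1 - \<epsilon>\<close> and mean at most \<open>a - \<epsilon>\<close>.\<close>

lemma taboo_drift_powr:
  assumes V [measurable]: "V \<in> borel_measurable S" and V1: "\<And>x. x \<in> space S \<Longrightarrow> 1 \<le> V x"
    and lam: "0 < lam" and p: "0 \<le> p" "p \<le> 1" and a: "1 \<le> a"
    and drift: "\<And>x. x \<in> space S - C \<Longrightarrow> kernel_fun P V x \<le> ennreal (lam * V x)"
    and C_le: "\<And>x. x \<in> C \<Longrightarrow> kernel_fun P V x \<le> ennreal a"
    and contr: "\<epsilon> < 1 \<Longrightarrow> (1 - \<epsilon>) * ((a - \<epsilon>) / (1 - \<epsilon>)) powr p \<le> lam powr p"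
    and x: "x \<in> space S"
  shows "(\<integral>\<^sup>+y. ennreal (V y powr p) \<partial>taboo x) \<le> ennreal (lam powr p) * ennreal (V x powr p)"
proof (cases "x \<in> C")
  case False
  have "(\<integral>\<^sup>+y. ennreal (V y powr p) \<partial>P x) \<le> ennreal (1 * (lam * V x) powr p)"
  proof (rule nn_integral_powr_le)
    show "V \<in> borel_measurable (P x)"
      using V sets_P[OF x] by (simp cong: measurable_cong_sets)
    show "emeasure (P x) (space (P x)) \<le> ennreal 1"
      by (simp add: prob_space.emeasure_space_1[OF prob_space_P[OF x]])
    show "0 < V y" if "y \<in> space (P x)" for y
      using V1[of y] that by (simp add: sets_eq_imp_space_eq[OF sets_P[OF x]])
    show "0 < lam * V x"
      using V1[OF x] lam by simp
  qed (use p drift x False in \<open>auto simp: kernel_fun_def\<close>)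
  with False lam V1[OF x] show ?thesis
    by (simp add: taboo_def powr_mult ennreal_mult')
next
  case True
  have V1x: "1 \<le> V x powr p"
    using V1[OF x] p by (simp add: ge_one_powr_ge_zero)
  show ?thesis
  proof (cases "\<epsilon> = 1")
    case \<epsilon>1: True
    \<comment> \<open>For \<epsilon> = 1 no mass is left on \<open>C\<close>, so there is nothing to
      estimate.\<close>
    have "emeasure (taboo x) (space (taboo x)) = 0"
      unfolding sets_eq_imp_space_eq[OF sets_taboo[OF x]] emeasure_taboo_space[OF x]
      using True \<epsilon>1 by simp
    then have "taboo x = null_measure (taboo x)"
      by (intro measure_eqI) (auto intro: emeasure_eq_0[OF sets.top _ sets.sets_into_space])
    then have "(\<integral>\<^sup>+y. ennreal (V y powr p) \<partial>taboo x) = 0"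
      by (metis nn_integral_null_measure)
    then show ?thesis by simp
  next
    case False
    then have "\<epsilon> < 1" using eps by simp
    interpret \<nu>: prob_space \<nu> by (rule prob_space_nu)
    \<comment> \<open>As \<open>\<nu>(V) \<ge> 1\<close>, removing \<open>\<epsilon> \<nu>\<close>
      lowers the integral of \<open>V\<close> by at least \<epsilon>; this is the numerator of
      \<open>J\<close>.\<close>
    have "(\<integral>\<^sup>+y. 1 \<partial>\<nu>) \<le> (\<integral>\<^sup>+y. ennreal (V y) \<partial>\<nu>)"
      using V1 by (intro nn_integral_mono) (simp add: space_nu)
    then have "ennreal \<epsilon> * 1 \<le> ennreal \<epsilon> * (\<integral>\<^sup>+y. ennreal (V y) \<partial>\<nu>)"
      by (intro mult_left_mono) (simp_all add: \<nu>.emeasure_space_1)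
    then have "ennreal \<epsilon> + (\<integral>\<^sup>+y. ennreal (V y) \<partial>taboo x) \<le> kernel_fun P V x"
      unfolding kernel_fun_def using True
      by (subst nn_integral_P_eq_taboo[OF x]) (auto intro: add_right_mono)
    also have "\<dots> \<le> ennreal a"
      by (rule C_le[OF True])
    also have "\<dots> = ennreal \<epsilon> + ennreal (a - \<epsilon>)"
      using eps a by (simp add: ennreal_plus[symmetric] del: ennreal_plus)
    finally have mean: "(\<integral>\<^sup>+y. ennreal (V y) \<partial>taboo x) \<le> ennreal (a - \<epsilon>)"
      by (simp add: ennreal_add_left_cancel_le)
    have "(\<integral>\<^sup>+y. ennreal (V y powr p) \<partial>taboo x) \<le> ennreal ((1 - \<epsilon>) * ((a - \<epsilon>) / (1 - \<epsilon>)) powr p)"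
    proof (rule nn_integral_powr_le)
      show "V \<in> borel_measurable (taboo x)"
        using V sets_taboo[OF x] by (simp cong: measurable_cong_sets)
      show "emeasure (taboo x) (space (taboo x)) \<le> ennreal (1 - \<epsilon>)"
        using emeasure_taboo_space[OF x] True by (simp add: sets_eq_imp_space_eq[OF sets_taboo[OF x]])
      show "0 < V y" if "y \<in> space (taboo x)" for y
        using V1[of y] that by (simp add: sets_eq_imp_space_eq[OF sets_taboo[OF x]])
      show "(\<integral>\<^sup>+y. ennreal (V y) \<partial>taboo x) \<le> ennreal ((1 - \<epsilon>) * ((a - \<epsilon>) / (1 - \<epsilon>)))"
        using mean \<open>\<epsilon> < 1\<close> by simp
    qed (use p a \<open>\<epsilon> < 1\<close> in auto)
    \<comment> \<open>\<open>V x powr p \<ge> 1\<close> turns a constant bound into one proportional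
      to the function.\<close>
    also have "\<dots> \<le> ennreal (lam powr p * V x powr p)"
      using contr[OF \<open>\<epsilon> < 1\<close>] mult_left_mono[OF V1x, of "lam powr p"] by (intro ennreal_leI) simp
    finally show ?thesis
      by (simp add: ennreal_mult')
  qed
qed

text \<open>Since \<open>V^p \<ge> 1\<close>, the mass is at most the integral of
  \<open>V^p\<close>, which shrinks by \<open>r\<close> at each step. Its initial value
  \<open>\<pi>(V^p)\<close> is finite by the drift bound with additive constant
  \<open>\<epsilon> * v^p\<close>, where Jensen's inequality bounds
  \<open>\<nu>(V^p)\<close>.\<close>

lemma measure_taboo_iter_invariant_le:
  assumes \<pi>: "invariant_prob S P \<pi>" and V [measurable]: "V \<in> borel_measurable S"
    and V1: "\<And>x. x \<in> space S \<Longrightarrow> 1 \<le> V x" and p: "0 \<le> p" "p \<le> 1"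
    and r: "0 < r" "r < 1" and v: "(\<integral>\<^sup>+y. ennreal (V y) \<partial>\<nu>) \<le> ennreal v" "0 < v"
    and drift: "\<And>x. x \<in> space S \<Longrightarrow>
      (\<integral>\<^sup>+y. ennreal (V y powr p) \<partial>taboo x) \<le> ennreal r * ennreal (V x powr p)"
  shows "measure (taboo_iter \<pi> n) (space S) \<le> r ^ n * (\<epsilon> * v powr p / (1 - r))"
proof -
  have \<pi>p: "\<pi> \<in> space (prob_algebra S)"
    using \<pi> by (simp add: invariant_prob_def)
  have powr1: "1 \<le> V x powr p" if "x \<in> space S" for x
    using V1[OF that] p by (simp add: ge_one_powr_ge_zero)
  have "(\<integral>\<^sup>+y. ennreal (V y powr p) \<partial>\<nu>) \<le> ennreal (1 * v powr p)"
  proof (rule nn_integral_powr_le)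
    show "emeasure \<nu> (space \<nu>) \<le> ennreal 1"
      by (simp add: prob_space.emeasure_space_1[OF prob_space_nu])
    show "0 < V y" if "y \<in> space \<nu>" for y
      using V1[of y] that by (simp add: space_nu)
  qed (use p v in auto)
  then have \<nu>: "(\<integral>\<^sup>+y. ennreal (V y powr p) \<partial>\<nu>) \<le> ennreal (v powr p)"
    by simp
  have "(\<integral>\<^sup>+x. ennreal (V x powr p) \<partial>\<pi>) \<le> ennreal (\<epsilon> * v powr p / (1 - r))"
  proof (rule invariant_prob_drift[OF kernel \<pi>])
    fix x assume x: "x \<in> space S"
    have "(\<integral>\<^sup>+y. ennreal (V y powr p) \<partial>P x) = ennreal \<epsilon> * indicator C x * (\<integral>\<^sup>+y. ennreal (V y powr p) \<partial>\<nu>) +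
        (\<integral>\<^sup>+y. ennreal (V y powr p) \<partial>taboo x)"
      by (rule nn_integral_P_eq_taboo[OF x]) measurable
    also have "\<dots> \<le> ennreal \<epsilon> * 1 * ennreal (v powr p) + ennreal r * ennreal (V x powr p)"
      using \<nu> drift[OF x] by (intro add_mono mult_mono) (auto simp: indicator_def)
    also have "\<dots> = ennreal (r * V x powr p + \<epsilon> * v powr p)"
      using eps r by (simp add: ennreal_mult' add.commute)
    finally show "(\<integral>\<^sup>+y. ennreal (V y powr p) \<partial>P x) \<le> ennreal (r * V x powr p + \<epsilon> * v powr p)" .
  qed (use r eps in auto)
  moreover have "(\<integral>\<^sup>+x. ennreal (V x powr p) \<partial>taboo_iter \<pi> n) \<le> ennreal r ^ n * (\<integral>\<^sup>+x. ennreal (V x powr p) \<partial>\<pi>)"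
    by (rule nn_integral_taboo_iter_le[OF \<pi>p _ drift]) measurable
  moreover have "(\<integral>\<^sup>+x. 1 \<partial>taboo_iter \<pi> n) \<le> (\<integral>\<^sup>+x. ennreal (V x powr p) \<partial>taboo_iter \<pi> n)"
    using powr1 by (intro nn_integral_mono) (simp add: space_taboo_iter[OF \<pi>p])
  ultimately have "emeasure (taboo_iter \<pi> n) (space S) \<le> ennreal r ^ n * ennreal (\<epsilon> * v powr p / (1 - r))"
    by (simp add: space_taboo_iter[OF \<pi>p]) (meson mult_left_mono order_trans zero_le)
  also have "\<dots> = ennreal (r ^ n * (\<epsilon> * v powr p / (1 - r)))"
    using r by (simp add: ennreal_power ennreal_mult'[symmetric])
  finally show ?thesis
    using r eps by (auto simp: measure_def intro!: enn2real_leI)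
qed

end

section \<open>The total variation bound from the tail mass of \<open>\<pi> T^M\<close>\<close>

theorem theorem3:
  fixes S :: "'a measure" and P :: "'a \<Rightarrow> 'a measure" and \<pi> \<nu> :: "'a measure"
    and C :: "'a set" and V :: "'a \<Rightarrow> real"
    and \<epsilon> lam b \<gamma> \<beta> J g :: real and A :: ennreal and M :: nat
    and \<Omega> :: "'w measure" and X' :: "nat \<Rightarrow> 'w \<Rightarrow> 'a \<times> bool"
  assumes kernel: "P \<in> S \<rightarrow>\<^sub>M prob_algebra S"
    and Harris: "positive_Harris_recurrent S P \<pi>"
    and C: "C \<in> sets S" "0 < measure \<pi> C"
    and \<epsilon>: "0 < \<epsilon>"
    and \<nu>: "\<nu> \<in> space (prob_algebra S)"
    and minorization: "\<And>x B. x \<in> C \<Longrightarrow> B \<in> sets S \<Longrightarrow> \<epsilon> * measure \<nu> B \<le> measure (P x) B"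
    and V: "V \<in> borel_measurable S" "\<And>x. x \<in> space S \<Longrightarrow> 1 \<le> V x"
    and lam: "0 < lam" "lam < 1"
    and drift: "\<And>x. x \<in> space S \<Longrightarrow> kernel_fun P V x \<le> ennreal (lam * V x + b * indicator C x)"
    and A: "A = sup_PV P V C"
    and J: "J = J_const A \<epsilon> lam"
    and \<gamma>: "0 < \<gamma>"
    and \<beta>: "1 < \<beta>" "\<beta> < beta_star A \<epsilon> lam"
    and g: "g = g_const lam (\<integral>y. V y \<partial>\<nu>) \<beta> \<epsilon> J"
    and M: "0 < M" "ln (2 * g / (\<gamma> * (\<beta> - 1))) / ln \<beta> < real M"
    and split_chain: "markov_chain \<Omega> (split_space S) (split_kernel P C \<epsilon> \<nu>) X'"
    and start: "0 < measure \<Omega> {\<omega> \<in> space \<Omega>. X' 0 \<omega> \<in> atom C}"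
  shows "tv_dist \<pi> (pi_tilde S \<Omega> X' (atom C) M) \<le> \<gamma>"
proof -
  have inv: "invariant_prob S P \<pi>"
    using Harris by (simp add: positive_Harris_recurrent_def)
  then have s\<pi>: "sets \<pi> = sets S"
    by (auto simp: invariant_prob_def space_prob_algebra)
  have p\<nu>: "prob_space \<nu>" and s\<nu>: "sets \<nu> = sets S"
    using \<nu> by (auto simp: space_prob_algebra)
  have sp\<nu>: "space \<nu> = space S"
    using s\<nu> by (rule sets_eq_imp_space_eq)
  obtain x0 where x0: "x0 \<in> C"
    using C(2) by (cases "C = {}") auto
  then have x0S: "x0 \<in> space S"
    using sets.sets_into_space[OF C(1)] by auto
  interpret P0: prob_space "P x0"
    using measurable_space[OF kernel x0S] by (simp add: space_prob_algebra)
  have sP0: "sets (P x0) = sets S"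
    using measurable_space[OF kernel x0S] by (simp add: space_prob_algebra)
  \<comment> \<open>Compare total masses in the minorization at a point of \<open>C\<close>, which
    is nonempty as it has positive \<pi>-measure.\<close>
  have "\<epsilon> \<le> 1"
    using minorization[OF x0 sets.top] P0.prob_space prob_space.prob_space[OF p\<nu>]
    by (simp add: sp\<nu>[symmetric] sets_eq_imp_space_eq[OF sP0, symmetric])
       (simp add: sp\<nu> sets_eq_imp_space_eq[OF sP0])
  interpret split_chain S P C \<epsilon> \<nu> \<Omega> X'
    by unfold_locales (fact kernel C(1) \<epsilon> \<open>\<epsilon> \<le> 1\<close> \<nu> minorization split_chain | assumption)+
  define p where "p = phi lam \<beta>"
  define v where "v = (\<integral>y. V y \<partial>\<nu>)"
  define a where "a = enn2real A"
  \<comment> \<open>For infinite \<open>A\<close> the default \<open>beta_star = 1\<close> leaves no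
    room for \<beta>.\<close>
  have "A \<noteq> \<infinity>"
    using \<beta> by (auto simp: beta_star_def)
  then have Aa: "A = ennreal a"
    by (simp add: a_def ennreal_enn2real less_top)
  have A_upper: "kernel_fun P V x \<le> ennreal a" if "x \<in> C" for x
    using that unfolding Aa[symmetric] A sup_PV_def by (rule SUP_upper)
  have "(\<integral>\<^sup>+y. 1 \<partial>P x0) \<le> kernel_fun P V x0"
    unfolding kernel_fun_def
    using V(2) by (intro nn_integral_mono) (simp add: sets_eq_imp_space_eq[OF sP0])
  also note A_upper[OF x0]
  finally have a: "1 \<le> a"
    by (simp add: P0.emeasure_space_1 ennreal_ge_1)
  have Ja: "J = (a - \<epsilon>) / lam"
    by (simp add: J J_const_def a_def)
  have p0: "0 < p"
    unfolding p_def by (rule phi_gt_0[OF lam \<beta>(1)])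
  have lp: "lam powr p = inverse \<beta>"
    unfolding p_def by (rule lam_powr_phi[OF lam \<beta>(1)])
  have contr: "(1 - \<epsilon>) * (J / (1 - \<epsilon>)) powr p < 1" "p < 1" if "\<epsilon> < 1"
    using beta_star_imp[of \<epsilon> a lam \<beta>] \<epsilon> that a lam \<beta> by (auto simp: p_def Ja Aa)
  have p1: "p < 1"
  proof (cases "\<epsilon> = 1")
    case True
    then have "ln \<beta> < ln (inverse lam)"
      using \<beta> lam \<open>A \<noteq> \<infinity>\<close> by (simp add: beta_star_def del: ln_inverse)
    then show ?thesis
      using lam by (simp add: p_def phi_def ln_inverse neg_less_divide_eq)
  qed (use contr \<open>\<epsilon> \<le> 1\<close> in auto)
  \<comment> \<open>\<open>a - \<epsilon> = J * lam\<close>, and \<open>lam powr p\<close> is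
    \<open>1/\<beta>\<close>; this links the Jensen bound on \<open>C\<close> with the expression in
    \<open>g\<close>.\<close>
  have scale: "((a - \<epsilon>) / (1 - \<epsilon>)) powr p = (J / (1 - \<epsilon>)) powr p * inverse \<beta>" if "\<epsilon> < 1"
  proof -
    have "(a - \<epsilon>) / (1 - \<epsilon>) = J / (1 - \<epsilon>) * lam"
      using lam by (simp add: Ja)
    moreover have "0 \<le> J / (1 - \<epsilon>)"
      using lam a that by (simp add: Ja)
    ultimately show ?thesis
      using lam by (simp only: powr_mult less_imp_le lp)
  qed
  \<comment> \<open>\<open>\<epsilon> \<nu>(V)\<close> is part of \<open>PV(x0)\<close>, which is at
    most \<open>A\<close>. Finiteness makes the Bochner integral in \<open>g\<close> the true value
    and not the default 0.\<close>
  have \<nu>V: "(\<integral>\<^sup>+y. ennreal (V y) \<partial>\<nu>) < \<infinity>"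
  proof -
    have "ennreal \<epsilon> * (\<integral>\<^sup>+y. ennreal (V y) \<partial>\<nu>) \<le> kernel_fun P V x0"
      unfolding kernel_fun_def using x0 V
      by (subst nn_integral_P_eq_taboo[OF x0S]) auto
    also have "\<dots> < \<infinity>"
      using A_upper[OF x0] by (auto intro: le_less_trans)
    finally show ?thesis
      using \<epsilon> by (auto simp: ennreal_mult_less_top)
  qed
  have V\<nu>: "V \<in> borel_measurable \<nu>" "\<And>y. y \<in> space \<nu> \<Longrightarrow> 1 \<le> V y"
    using V s\<nu> by (auto simp: sp\<nu> cong: measurable_cong_sets)
  have V0: "AE y in \<nu>. 0 \<le> V y"
    using V\<nu>(2) by (intro AE_I2) force
  have int: "integrable \<nu> V"
    using V\<nu>(1) V0 \<nu>V by (intro integrableI_nonneg) auto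
  have v_eq: "(\<integral>\<^sup>+y. ennreal (V y) \<partial>\<nu>) = ennreal v"
    unfolding v_def by (rule nn_integral_eq_integral[OF int V0])
  have "1 \<le> v"
    unfolding v_def using prob_space.integral_ge_const[OF p\<nu> int, of 1] V\<nu>(2) by auto
  have "measure (taboo_iter \<pi> M) (space S) \<le> inverse \<beta> ^ M * (\<epsilon> * v powr p / (1 - inverse \<beta>))"
  proof (rule measure_taboo_iter_invariant_le[OF inv V])
    fix x assume x: "x \<in> space S"
    show "(\<integral>\<^sup>+y. ennreal (V y powr p) \<partial>taboo x) \<le> ennreal (inverse \<beta>) * ennreal (V x powr p)"
      unfolding lp[symmetric]
    proof (rule taboo_drift_powr[OF V lam(1) _ _ a _ A_upper _ x])
      show "kernel_fun P V x \<le> ennreal (lam * V x)" if "x \<in> space S - C" for x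
        using drift[of x] that by simp
      show "(1 - \<epsilon>) * ((a - \<epsilon>) / (1 - \<epsilon>)) powr p \<le> lam powr p" if "\<epsilon> < 1"
        using contr(1)[OF that] \<beta>(1) by (simp add: scale[OF that] lp mult_le_cancel_right1 flip: mult.assoc)
    qed (use p0 p1 in auto)
  qed (use p0 p1 \<beta> v_eq \<open>1 \<le> v\<close> in \<open>auto simp: inverse_less_1_iff\<close>)
  also have "\<dots> \<le> inverse \<beta> ^ M * (\<beta> * v powr p / (\<beta> - 1))"
  proof -
    have "\<epsilon> * v powr p / (1 - inverse \<beta>) = \<epsilon> * (\<beta> * v powr p / (\<beta> - 1))"
      using \<beta> by (simp add: field_simps)
    also have "\<dots> \<le> \<beta> * v powr p / (\<beta> - 1)"
      using \<beta> \<epsilon> \<open>\<epsilon> \<le> 1\<close> by (intro mult_left_le_one_le) auto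
    finally show ?thesis
      using \<beta> by (intro mult_left_mono) auto
  qed
  also have "\<dots> \<le> inverse \<beta> ^ M * (g / (\<beta> - 1))"
  proof -
    \<comment> \<open>The fraction in \<open>g\<close> is at least 1: \<open>a \<ge> 1\<close> gives
      \<open>(a - \<epsilon>) / (1 - \<epsilon>) \<ge> 1\<close>, hence
      \<open>?K \<ge> \<beta>\<close>, and the denominator is positive by the contraction
      condition.\<close>
    have "\<beta> * v powr p \<le> g"
    proof (cases "\<epsilon> = 1")
      case False
      then have \<epsilon>1: "\<epsilon> < 1" using \<open>\<epsilon> \<le> 1\<close> by simp
      let ?K = "(J / (1 - \<epsilon>)) powr p"
      have "1 \<le> ((a - \<epsilon>) / (1 - \<epsilon>)) powr p"
        using a \<epsilon>1 p0 by (intro ge_one_powr_ge_zero) auto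
      then have "\<beta> \<le> ?K"
        using \<beta> by (simp add: scale[OF \<epsilon>1] field_simps)
      then have "1 - (1 - \<epsilon>) * ?K \<le> 1 - \<beta> * (1 - \<epsilon>)"
        using \<epsilon>1 by (simp add: mult.commute)
      then have "1 \<le> (1 - \<beta> * (1 - \<epsilon>)) / (1 - (1 - \<epsilon>) * ?K)"
        using contr(1)[OF \<epsilon>1] by simp
      from mult_left_mono[OF this, of "\<beta> * v powr p"] show ?thesis
        using \<beta> False by (simp add: g g_const_def v_def p_def)
    qed (simp add: g g_const_def v_def p_def)
    then show ?thesis
      using \<beta> by (intro mult_left_mono divide_right_mono) auto
  qed
  also have "\<dots> \<le> \<gamma>"
  \<comment> \<open>The lower bound on \<open>M\<close> says
    \<open>2 * g / (\<gamma> * (\<beta> - 1)) < \<beta>^M\<close>, so the tail is below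
    \<open>\<gamma>/2\<close>. The sign of \<open>g\<close> is split off so that logarithms are
    compared at positive arguments only.\<close>
  proof (cases "0 < g")
    case True
    then have "ln (2 * g / (\<gamma> * (\<beta> - 1))) < ln (\<beta> ^ M)"
      using M(2) \<beta> by (simp add: pos_divide_less_eq ln_realpow)
    then have "2 * g / (\<gamma> * (\<beta> - 1)) < \<beta> ^ M"
      using True \<beta> \<gamma> by (subst (asm) ln_less_cancel_iff) auto
    then show ?thesis
      using True \<beta> \<gamma> by (simp add: field_simps power_inverse)
  next
    case False
    then have "inverse \<beta> ^ M * (g / (\<beta> - 1)) \<le> 0"
      using \<beta> by (intro mult_nonneg_nonpos divide_nonpos_nonneg) auto
    with \<gamma> show ?thesis by simp
  qed
  finally have tail: "measure (taboo_iter \<pi> M) (space S) \<le> \<gamma>" .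
  have "0 < measure \<Omega> (excursion 0)"
    using start by (simp add: excursion_def)
  then have "\<bar>measure \<pi> B - measure (pi_tilde S \<Omega> X' (atom C) M) B\<bar> \<le> \<gamma>" if "B \<in> sets S" for B
    using abs_measure_diff_truncated_mixture_le[OF inv M(1) that] tail
    by (simp add: measure_pi_tilde[OF that])
  then show ?thesis
    unfolding tv_dist_def s\<pi> by (intro cSUP_least) auto
qed

end
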